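(* Let $n\ge 3$ and let $|\Psi\rangle$ be an $n$-qubit pure state. Let $\mathcal{G}(|\Psi\rangle)$ be its generalized geometric measure, and suppose that the maximum in the definition of $\mathcal{G}(|\Psi\rangle)$ is attained at a bipartition $\{j\}:\{1,\dots,n\}\setminus\{j\}$ in which one side is a single qubit $j$. Equivalently, the largest eigenvalue among all reduced density matrices of $|\Psi\rangle$ (over all bipartitions) is attained by a single-qubit reduced density matrix $\rho^{(1)}_j$. Then the monogamy score satisfies: (i) $\delta^{\mathcal{C}^2}(|\Psi\rangle)\le 4\,\mathcal{G}(|\Psi\rangle)\bigl(1-\mathcal{G}(|\Psi\rangle)\bigr)$; (ii) $\delta^{\mathcal{N}^2}(|\Psi\rangle)\le \mathcal{G}(|\Psi\rangle)\bigl(1-\mathcal{G}(|\Psi\rangle)\bigr)$; (iii) $\delta^{\mathcal{D}}(|\Psi\rangle)\le h(\mathcal{G}(|\Psi\rangle))$; (iv) $\delta^{\Delta}(|\Psi\rangle)\le h(\mathcal{G}(|\Psi\rangle))$. Here $h(x)=-x\log_2x-(1-x)\log_2(1-x)$ is the binary Shannon entropy.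
   Context: Generalized geometric measure (GGM). For an $n$-qubit pure state $|\Psi\rangle$, let $\lambda_{A:B}$ denote the maximal Schmidt coefficient of $|\Psi\rangle$ across the bipartition $A:B$, where $A\cup B=\{1,\dots,n\}$, $A\cap B=\emptyset$ and $A,B\neq\emptyset$. Then $$\mathcal{G}(|\Psi\rangle)=1-\max_{A:B}\lambda_{A:B}^2.$$ Note that $\lambda_{A:B}^2$ is the largest eigenvalue of the reduced density matrix $\rho_A=\mathrm{Tr}_B|\Psi\rangle\langle\Psi|$. Monogamy score. For a bipartite quantum correlation measure $\mathcal{Q}$ and a node $j\in\{1,\dots,n\}$, define $$\delta^{\mathcal{Q}}_j(|\Psi\rangle)=\mathcal{Q}(\rho_{j:\mathrm{rest}})-\sum_{k\ne j}\mathcal{Q}(\rho^{(2)}_{jk}).$$ Here $\rho_{j:\mathrm{rest}}=|\Psi\rangle\langle\Psi|$ is viewed as a bipartite state of qubit $j$ versus the remaining $n-1$ qubits, and $\rho^{(2)}_{jk}$ is the two-qubit reduced density matrix of qubits $j,k$, with $j$ as the first party. The monogamy score is $\delta^{\mathcal{Q}}(|\Psi\rangle)=\min_{j}\delta^{\mathcal{Q}}_j(|\Psi\rangle)$. Measures. - $\mathcal{C}^2$ is the squared concurrence. For a two-qubit state $\rho$, $\mathcal{C}(\rho)=\max\{0,\lambda_1-\lambda_2-\lambda_3-\lambda_4\}$, where the $\lambda_i$ are the square roots of the eigenvalues of $\rho(\sigma_y\otimes\sigma_y)\rho^*(\sigma_y\otimes\sigma_y)$ in decreasing order. For a pure state of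 a qubit $A$ versus a system $B$, $\mathcal{C}=2\sqrt{\det\rho_A}$. - $\mathcal{N}^2$ is the squared negativity, with $\mathcal{N}(\rho_{AB})=(\|\rho_{AB}^{T_A}\|_1-1)/2$. - $\mathcal{D}$ is the quantum discord with measurement on the first party $A$. It is defined by $\mathcal{D}(\rho_{AB})=\mathcal{I}(\rho_{AB})-\mathcal{J}(\rho_{AB})$, where $\mathcal{I}=S(\rho_A)+S(\rho_B)-S(\rho_{AB})$ and $\mathcal{J}=S(\rho_B)-\min_{\{A_i\}}\sum_ip_iS(\rho_{B|i})$. The minimum is over rank-one projective measurements $\{A_i\}$ on $A$, with $p_i=\mathrm{tr}[(A_i\otimes I)\rho_{AB}(A_i\otimes I)]$ and $\rho_{B|i}=\mathrm{tr}_A[(A_i\otimes I)\rho_{AB}(A_i\otimes I)]/p_i$. Here $S$ is the von Neumann entropy (base 2). - $\Delta$ is the (one-way) quantum work-deficit, $\Delta(\rho_{AB})=\min_{\{A_i\}}S\bigl(\sum_i(A_i\otimes I)\rho_{AB}(A_i\otimes I)\bigr)-S(\rho_{AB})$, with the minimum over rank-one projective measurements on $A$. *)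

theory Defs
  imports "Jordan_Normal_Form.Char_Poly" "HOL-Library.Multiset"
begin

definition eig_mset :: "complex mat \<Rightarrow> complex multiset" where
  "eig_mset M = (\<Sum>x\<in>{x. poly (char_poly M) x = 0}. replicate_mset (order x (char_poly M)) x)"

text \<open>Largest eigenvalue (used for Hermitian matrices, whose eigenvalues are real).\<close>
definition max_eig :: "complex mat \<Rightarrow> real" where
  "max_eig M = Max (Re ` set_mset (eig_mset M))"

text \<open>von Neumann entropy, base 2 (convention 0 log 0 = 0 holds since log 2 0 = 0 in Isabelle).\<close>
definition vn_entropy :: "complex mat \<Rightarrow> real" where
  "vn_entropy M = - sum_mset (image_mset (\<lambda>mu. Re mu * log 2 (Re mu)) (eig_mset M))"

definition mtrace :: "complex mat \<Rightarrow> complex" where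
  "mtrace M = (\<Sum>i<dim_row M. M $$ (i, i))"

definition adj :: "complex mat \<Rightarrow> complex mat" where
  "adj M = mat (dim_col M) (dim_row M) (\<lambda>(i, j). cnj (M $$ (j, i)))"

definition cconj :: "complex mat \<Rightarrow> complex mat" where
  "cconj M = map_mat cnj M"

definition trace_norm :: "complex mat \<Rightarrow> real" where
  "trace_norm M = sum_mset (image_mset (\<lambda>mu. sqrt (Re mu)) (eig_mset (adj M * M)))"

definition cinner :: "complex vec \<Rightarrow> complex vec \<Rightarrow> complex" where
  "cinner u v = (\<Sum>i<dim_vec u. cnj (u $ i) * v $ i)"

definition proj_vec :: "complex vec \<Rightarrow> complex mat" where
  "proj_vec v = mat (dim_vec v) (dim_vec v) (\<lambda>(i, j). v $ i * cnj (v $ j))"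

definition kron2 :: "complex mat \<Rightarrow> complex mat \<Rightarrow> complex mat" where
  "kron2 A B = mat 4 4 (\<lambda>(i, j). A $$ (i div 2, j div 2) * B $$ (i mod 2, j mod 2))"

definition sigma_y :: "complex mat" where
  "sigma_y = mat 2 2 (\<lambda>(i, j). if i = 0 \<and> j = 1 then - \<i> else if i = 1 \<and> j = 0 then \<i> else 0)"

text \<open>Computational basis index x < 2^n; qubit q (0-based, q < n) is bit q of x.
  A local index r < 2^(card A) for a subset A of qubits is mapped to the global
  index by placing bit t of r at the t-th smallest element of A.\<close>
definition spread :: "nat set \<Rightarrow> nat \<Rightarrow> nat" where
  "spread A r = (\<Sum>t<card A. if odd (r div 2 ^ t) then 2 ^ (sorted_list_of_set A ! t) else 0)"

definition pure_state :: "nat \<Rightarrow> complex vec \<Rightarrow> bool" where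
  "pure_state n psi \<longleftrightarrow> psi \<in> carrier_vec (2 ^ n) \<and> (\<Sum>i<2 ^ n. (cmod (psi $ i))\<^sup>2) = 1"

definition red :: "nat \<Rightarrow> nat set \<Rightarrow> complex vec \<Rightarrow> complex mat" where
  "red n A psi = (let B = {..<n} - A in
     mat (2 ^ card A) (2 ^ card A)
       (\<lambda>(r, c). \<Sum>s<2 ^ card B. psi $ (spread A r + spread B s) * cnj (psi $ (spread A c + spread B s))))"

text \<open>Two-qubit reduced density matrix of qubits j,k with j the first party (local index 2a+b).\<close>
definition red2 :: "nat \<Rightarrow> nat \<Rightarrow> nat \<Rightarrow> complex vec \<Rightarrow> complex mat" where
  "red2 n j k psi = (let R = {..<n} - {j, k} in
     mat 4 4 (\<lambda>(r, c). \<Sum>s<2 ^ card R.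
        psi $ ((r div 2) * 2 ^ j + (r mod 2) * 2 ^ k + spread R s)
        * cnj (psi $ ((c div 2) * 2 ^ j + (c mod 2) * 2 ^ k + spread R s))))"

text \<open>The state psi viewed as a bipartite state qubit j : rest (local index a * 2^(n-1) + s).\<close>
definition split_vec :: "nat \<Rightarrow> nat \<Rightarrow> complex vec \<Rightarrow> complex vec" where
  "split_vec n j psi = (let R = {..<n} - {j} in
     vec (2 * 2 ^ (n - 1)) (\<lambda>i. psi $ ((i div 2 ^ (n - 1)) * 2 ^ j + spread R (i mod 2 ^ (n - 1)))))"

text \<open>Square of the maximal Schmidt coefficient maximised over bipartitions A:B,
  i.e. the largest eigenvalue among all reduced density matrices rho_A.\<close>
definition max_lambda_sq :: "nat \<Rightarrow> complex vec \<Rightarrow> real" where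
  "max_lambda_sq n psi = Max {max_eig (red n A psi) | A. A \<subseteq> {..<n} \<and> A \<noteq> {} \<and> A \<noteq> {..<n}}"

definition GGM :: "nat \<Rightarrow> complex vec \<Rightarrow> real" where
  "GGM n psi = 1 - max_lambda_sq n psi"

section \<open>Bipartite states: qubit A (first) and system B of dimension d, dim rho = 2d,
  index a*d + b\<close>

definition ptrace_B :: "complex mat \<Rightarrow> complex mat" where
  "ptrace_B rho = (let d = dim_row rho div 2 in
     mat 2 2 (\<lambda>(a, a'). \<Sum>b<d. rho $$ (a * d + b, a' * d + b)))"

definition ptrace_A :: "complex mat \<Rightarrow> complex mat" where
  "ptrace_A rho = (let d = dim_row rho div 2 in
     mat d d (\<lambda>(b, b'). \<Sum>a<2. rho $$ (a * d + b, a * d + b')))"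

definition ptrans_A :: "complex mat \<Rightarrow> complex mat" where
  "ptrans_A rho = (let d = dim_row rho div 2 in
     mat (dim_row rho) (dim_row rho)
       (\<lambda>(i, j). rho $$ ((j div d) * d + i mod d, (i div d) * d + j mod d)))"

definition liftA :: "complex mat \<Rightarrow> nat \<Rightarrow> complex mat" where
  "liftA P d = mat (2 * d) (2 * d) (\<lambda>(i, j). if i mod d = j mod d then P $$ (i div d, j div d) else 0)"

text \<open>Orthonormal basis {u0,u1} of C^2: rank-one projective measurement {|u0><u0|, |u1><u1|}.\<close>
definition onb2 :: "complex vec \<Rightarrow> complex vec \<Rightarrow> bool" where
  "onb2 u0 u1 \<longleftrightarrow> u0 \<in> carrier_vec 2 \<and> u1 \<in> carrier_vec 2 \<and>
     cinner u0 u0 = 1 \<and> cinner u1 u1 = 1 \<and> cinner u0 u1 = 0"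

definition post_meas :: "complex mat \<Rightarrow> complex vec \<Rightarrow> complex mat" where
  "post_meas rho u = (let d = dim_row rho div 2; P = liftA (proj_vec u) d in P * rho * P)"

definition meas_prob :: "complex mat \<Rightarrow> complex vec \<Rightarrow> real" where
  "meas_prob rho u = Re (mtrace (post_meas rho u))"

definition cond_state :: "complex mat \<Rightarrow> complex vec \<Rightarrow> complex mat" where
  "cond_state rho u = complex_of_real (1 / meas_prob rho u) \<cdot>\<^sub>m ptrace_A (post_meas rho u)"

definition cond_entropy_meas :: "complex mat \<Rightarrow> complex vec \<Rightarrow> complex vec \<Rightarrow> real" where
  "cond_entropy_meas rho u0 u1 =
     meas_prob rho u0 * vn_entropy (cond_state rho u0) + meas_prob rho u1 * vn_entropy (cond_state rho u1)"

definition mutual_info :: "complex mat \<Rightarrow> real" where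
  "mutual_info rho = vn_entropy (ptrace_B rho) + vn_entropy (ptrace_A rho) - vn_entropy rho"

definition classical_corr :: "complex mat \<Rightarrow> real" where
  "classical_corr rho = vn_entropy (ptrace_A rho)
     - Inf {cond_entropy_meas rho u0 u1 | u0 u1. onb2 u0 u1}"

definition discord :: "complex mat \<Rightarrow> real" where
  "discord rho = mutual_info rho - classical_corr rho"

definition work_deficit :: "complex mat \<Rightarrow> real" where
  "work_deficit rho = Inf {vn_entropy (post_meas rho u0 + post_meas rho u1) | u0 u1. onb2 u0 u1}
     - vn_entropy rho"

definition negativity :: "complex mat \<Rightarrow> real" where
  "negativity rho = (trace_norm (ptrans_A rho) - 1) / 2"

text \<open>Concurrence of a two-qubit state (Wootters).\<close>
definition conc2 :: "complex mat \<Rightarrow> real" where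
  "conc2 rho = (let Y = kron2 sigma_y sigma_y; R = rho * Y * cconj rho * Y;
      L = rev (sorted_list_of_multiset (image_mset (\<lambda>mu. sqrt (Re mu)) (eig_mset R)))
    in max 0 (L ! 0 - L ! 1 - L ! 2 - L ! 3))"

definition conc_pure1 :: "nat \<Rightarrow> nat \<Rightarrow> complex vec \<Rightarrow> real" where
  "conc_pure1 n j psi = 2 * sqrt (Re (det (red n {j} psi)))"

definition mono_score :: "nat \<Rightarrow> (nat \<Rightarrow> real) \<Rightarrow> (nat \<Rightarrow> nat \<Rightarrow> real) \<Rightarrow> real" where
  "mono_score n Qrest Q2 = Min ((\<lambda>j. Qrest j - (\<Sum>k\<in>{..<n} - {j}. Q2 j k)) ` {..<n})"

definition delta_C2 :: "nat \<Rightarrow> complex vec \<Rightarrow> real" where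
  "delta_C2 n psi = mono_score n (\<lambda>j. (conc_pure1 n j psi)\<^sup>2) (\<lambda>j k. (conc2 (red2 n j k psi))\<^sup>2)"

definition delta_N2 :: "nat \<Rightarrow> complex vec \<Rightarrow> real" where
  "delta_N2 n psi = mono_score n (\<lambda>j. (negativity (proj_vec (split_vec n j psi)))\<^sup>2)
                                 (\<lambda>j k. (negativity (red2 n j k psi))\<^sup>2)"

definition delta_D :: "nat \<Rightarrow> complex vec \<Rightarrow> real" where
  "delta_D n psi = mono_score n (\<lambda>j. discord (proj_vec (split_vec n j psi)))
                                (\<lambda>j k. discord (red2 n j k psi))"

definition delta_WD :: "nat \<Rightarrow> complex vec \<Rightarrow> real" where
  "delta_WD n psi = mono_score n (\<lambda>j. work_deficit (proj_vec (split_vec n j psi)))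
                                 (\<lambda>j k. work_deficit (red2 n j k psi))"

definition bin_entropy :: "real \<Rightarrow> real" where
  "bin_entropy x = - x * log 2 x - (1 - x) * log 2 (1 - x)"

end

theory Submission
  imports Defs "Jordan_Normal_Form.Schur_Decomposition"
begin

text \<open>
  Let \<open>j\<close> be a qubit whose reduced state attains the maximal eigenvalue \<open>\<lambda> = 1 - G\<close>. Its reduced
  state has eigenvalues \<open>\<lambda>\<close> and \<open>1 - \<lambda>\<close>, and the four measures of the pure state \<open>j : rest\<close> are
  functions of these two numbers, bounded by the right-hand sides. As the monogamy score is at
  most the term for \<open>j\<close>, it remains to see that the subtracted two-qubit quantities are nonnegative.
  This is only substantial for the discord, where it says that the relative entropy between a
  state and its locally dephased version does not increase under the partial trace. With
  \<open>r ln (r / s) = \<integral> (r\<^sup>2 / (s + t r) - r / (1 + t)) dt\<close> over \<open>(0, \<infinity>)\<close>, this reduces to an inequality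
  for each \<open>t\<close>, which follows from a variational formula for the integrand.
\<close>

subsection \<open>Unitary diagonalisation of Hermitian matrices\<close>

text \<open>Why a relative entropy appears: let \<open>sigma\<close> be \<open>rho\<close> dephased
  in the measured basis of the qubit A, with outcome distribution p. The spectrum of
  \<open>sigma\<close> consists of the spectra of the unnormalised conditional states, so the
  averaged conditional entropy is S(sigma) - H(p). The entropy of B cancels in the discord, and
  (S(sigma) - S(rho)) - (H(p) - S(rho_A)) remains. The diagonal of \<open>rho\<close> in an
  eigenbasis of \<open>sigma\<close> is the spectrum of \<open>sigma\<close>, so the first bracket
  is D(rho || sigma); likewise the second is D(rho_A || sigma_A). States may be singular, so no
  operator logarithm or inverse is formed. Everything is written with eigenvalues and squared
  overlaps of two eigenbases, and a term has nonzero weight only where its logarithm is taken at a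
  positive number. The integral is not formed either: an antiderivative in \<open>t\<close> is
  compared at 0 and at infinity. The subtracted r / (1 + t) only serves convergence, and it cancels
  because the partial trace preserves the trace. Spectra are defined as root multisets of
  characteristic polynomials; unitary diagonalisation turns them into finite real sums.\<close>

lemma mult_mat_index:
  assumes "A \<in> carrier_mat n m" "B \<in> carrier_mat m k" "i < n" "j < k"
  shows "(A * B) $$ (i, j) = (\<Sum>l<m. A $$ (i, l) * B $$ (l, j))"
  using assms by (auto simp: scalar_prod_def atLeast0LessThan intro!: sum.cong)

lemma adj_carrier [simp]: "A \<in> carrier_mat n m \<Longrightarrow> adj A \<in> carrier_mat m n"
  by (auto simp: adj_def)

lemma adj_carrier_square [simp]: "A \<in> carrier_mat n n \<Longrightarrow> adj A \<in> carrier_mat n n"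
  by simp

lemma mult_carrier_square [simp]:
  "A \<in> carrier_mat n n \<Longrightarrow> B \<in> carrier_mat n n \<Longrightarrow> A * B \<in> carrier_mat n n"
  by simp

lemma adj_index [simp]:
  "i < dim_col A \<Longrightarrow> j < dim_row A \<Longrightarrow> adj A $$ (i, j) = cnj (A $$ (j, i))"
  by (simp add: adj_def)

lemma adj_dim [simp]: "dim_row (adj A) = dim_col A" "dim_col (adj A) = dim_row A"
  by (auto simp: adj_def)

lemma adj_adj [simp]: "adj (adj A) = A"
  by (rule eq_matI) auto

lemma adj_one [simp]: "adj (1\<^sub>m n) = 1\<^sub>m n"
  by (rule eq_matI) auto

lemma adj_mult:
  assumes "A \<in> carrier_mat n m" "B \<in> carrier_mat m k"
  shows "adj (A * B) = adj B * adj A"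
proof (rule eq_matI)
  fix i j assume "i < dim_row (adj B * adj A)" "j < dim_col (adj B * adj A)"
  then show "adj (A * B) $$ (i, j) = (adj B * adj A) $$ (i, j)"
    using assms by (auto simp: scalar_prod_def intro!: sum.cong)
qed (use assms in auto)

definition diag_real :: "nat \<Rightarrow> (nat \<Rightarrow> real) \<Rightarrow> complex mat" where
  "diag_real n r = mat n n (\<lambda>(i, j). if i = j then complex_of_real (r i) else 0)"

lemma diag_real_carrier [simp]: "diag_real n r \<in> carrier_mat n n"
  by (simp add: diag_real_def)

lemma diag_real_dim [simp]: "dim_row (diag_real n r) = n" "dim_col (diag_real n r) = n"
  by (auto simp: diag_real_def)

lemma diag_real_index [simp]:
  "i < n \<Longrightarrow> j < n \<Longrightarrow> diag_real n r $$ (i, j) = (if i = j then complex_of_real (r i) else 0)"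
  by (simp add: diag_real_def)

lemma adj_diag_real [simp]: "adj (diag_real n r) = diag_real n r"
  by (rule eq_matI) auto

definition unitary :: "nat \<Rightarrow> complex mat \<Rightarrow> bool" where
  "unitary n V \<longleftrightarrow> V \<in> carrier_mat n n \<and> adj V * V = 1\<^sub>m n"

lemma unitary_carrier: "unitary n V \<Longrightarrow> V \<in> carrier_mat n n"
  by (simp add: unitary_def)

lemma unitary_left: "unitary n V \<Longrightarrow> adj V * V = 1\<^sub>m n"
  by (simp add: unitary_def)

lemma unitary_right: "unitary n V \<Longrightarrow> V * adj V = 1\<^sub>m n"
  using mat_mult_left_right_inverse[of "adj V" n V] by (simp add: unitary_def)

lemma unitary_mult:
  assumes V: "unitary n V" and W: "unitary n W"
  shows "unitary n (V * W)"
proof -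
  note c = unitary_carrier[OF V] unitary_carrier[OF W]
  have "adj (V * W) * (V * W) = adj W * ((adj V * V) * W)"
    using c by (simp add: adj_mult[OF c] assoc_mult_mat[of _ n n _ n _ n])
  then show ?thesis
    using c V W by (simp add: unitary_def)
qed

lemma unitary_adj: "unitary n V \<Longrightarrow> unitary n (adj V)"
  using unitary_right[of n V] by (simp add: unitary_def)

lemma unitary_cols:
  assumes "unitary n V" "k < n" "l < n"
  shows "(\<Sum>i<n. cnj (V $$ (i, k)) * V $$ (i, l)) = (if k = l then 1 else 0)"
proof -
  have "(adj V * V) $$ (k, l) = (\<Sum>i<n. cnj (V $$ (i, k)) * V $$ (i, l))"
    using assms unitary_carrier[OF assms(1)]
    by (subst mult_mat_index[of _ n n _ n]) (auto intro!: sum.cong)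
  then show ?thesis
    using assms by (simp add: unitary_left)
qed

lemma unitaryI_cols:
  assumes "V \<in> carrier_mat n n"
    and "\<And>k l. k < n \<Longrightarrow> l < n \<Longrightarrow>
      (\<Sum>i<n. cnj (V $$ (i, k)) * V $$ (i, l)) = (if k = l then 1 else 0)"
  shows "unitary n V"
proof -
  have "adj V * V = 1\<^sub>m n"
  proof (rule eq_matI)
    fix k l assume "k < dim_row (1\<^sub>m n)" "l < dim_col (1\<^sub>m n)"
    then have kl: "k < n" "l < n" by auto
    have "(adj V * V) $$ (k, l) = (\<Sum>i<n. cnj (V $$ (i, k)) * V $$ (i, l))"
      using assms(1) kl by (subst mult_mat_index[of _ n n _ n]) (auto intro!: sum.cong)
    then show "(adj V * V) $$ (k, l) = 1\<^sub>m n $$ (k, l)"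
      using assms(2)[OF kl] kl by simp
  qed (use assms(1) in auto)
  then show ?thesis
    using assms(1) by (simp add: unitary_def)
qed

definition spectral :: "nat \<Rightarrow> complex mat \<Rightarrow> complex mat \<Rightarrow> (nat \<Rightarrow> real) \<Rightarrow> bool" where
  "spectral n M V r \<longleftrightarrow> unitary n V \<and> M = V * diag_real n r * adj V"

lemma spectral_carrier: "spectral n M V r \<Longrightarrow> M \<in> carrier_mat n n"
  by (auto simp: spectral_def dest!: unitary_carrier) 

lemma spectral_unitary: "spectral n M V r \<Longrightarrow> unitary n V"
  by (simp add: spectral_def)

lemma spectral_diag:
  assumes "spectral n M V r"
  shows "adj V * M * V = diag_real n r"
proof -
  note u = spectral_unitary[OF assms]
  note c = unitary_carrier[OF u]
  have "adj V * M * V = (adj V * V) * diag_real n r * (adj V * V)"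
    using assms c by (simp add: spectral_def assoc_mult_mat[of _ n n _ n _ n])
  then show ?thesis
    using u by (simp add: unitary_left)
qed

text \<open>Complete \<open>v\<close> to a basis, apply Gram-Schmidt, which keeps the first vector,
  and normalise the columns. The factor \<open>c\<close> can stay unspecified, since an eigenvector
  matters only up to scale.\<close>

lemma unitary_with_first_column:
  assumes v: "v \<in> carrier_vec n" and v0: "v \<noteq> 0\<^sub>v n"
  obtains W c where "unitary n W" "\<And>i. i < n \<Longrightarrow> W $$ (i, 0) = c * v $ i"
proof -
  interpret cof_vec_space n "TYPE(complex)" .
  have n: "n \<noteq> 0"
    using v v0 by (metis carrier_vecD eq_vecI index_zero_vec(2) less_nat_zero_code)
  define b where "b = basis_completion v"
  define ws where "ws = gram_schmidt n b"
  from basis_completion[OF v v0, folded b_def]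
  have dist_b: "distinct b" and indep: "\<not> lin_dep (set b)" and b: "set b \<subseteq> carrier_vec n"
    and hdb: "hd b = v" and len_b: "length b = n" by auto
  from hdb len_b n obtain vs where bv: "b = v # vs" by (cases b) auto
  from gram_schmidt_result[OF b dist_b indep refl, folded ws_def]
  have ws: "set ws \<subseteq> carrier_vec n" "corthogonal ws" "length ws = n"
    by (auto simp: len_b)
  from gram_schmidt_hd[OF v, of vs, folded bv] have hdws: "hd ws = v"
    unfolding ws_def .
  have ws0: "ws ! 0 = v"
    using hdws ws n by (cases ws) auto
  define N where "N k = (\<Sum>i<n. (cmod (ws ! k $ i))\<^sup>2)" for k
  have dim: "dim_vec (ws ! k) = n" if "k < n" for k
    using ws that by (metis carrier_vecD nth_mem subsetD)
  have ip: "ws ! k \<bullet>c ws ! l = (\<Sum>i<n. ws ! k $ i * cnj (ws ! l $ i))" if "k < n" "l < n" for k l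
    using that by (auto simp: scalar_prod_def dim atLeast0LessThan intro!: sum.cong)
  have ipN: "(\<Sum>i<n. ws ! k $ i * cnj (ws ! k $ i)) = complex_of_real (N k)" for k
    by (simp add: N_def complex_norm_square[symmetric])
  have N0: "N k > 0" if "k < n" for k
  proof -
    \<comment> \<open>\<open>corthogonal\<close> also says that no vector is orthogonal to itself,
      which excludes zero vectors.\<close>
    have "ws ! k \<bullet>c ws ! k \<noteq> 0"
      using corthogonalD[OF ws(2), of k k] that ws(3) by auto
    then have "N k \<noteq> 0"
      using ip[OF that that] ipN[of k] by auto
    moreover have "N k \<ge> 0"
      unfolding N_def by (intro sum_nonneg) auto
    ultimately show ?thesis by simp
  qed
  define W where "W = mat n n (\<lambda>(i, k). complex_of_real (1 / sqrt (N k)) * ws ! k $ i)"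
  have "unitary n W"
  proof (rule unitaryI_cols)
    fix k l assume kl: "k < n" "l < n"
    have "(\<Sum>i<n. cnj (W $$ (i, k)) * W $$ (i, l)) =
        complex_of_real (1 / sqrt (N k) * (1 / sqrt (N l))) * (\<Sum>i<n. ws ! l $ i * cnj (ws ! k $ i))"
      unfolding sum_distrib_left using kl
      by (intro sum.cong) (auto simp: W_def)
    also have "\<dots> = (if k = l then 1 else 0)"
    proof (cases "k = l")
      case True
      have "1 / sqrt (N k) * (1 / sqrt (N k)) * N k = 1"
        using N0[OF kl(1)] by simp
      then show ?thesis
        using True unfolding ipN True of_real_mult[symmetric] by simp
    next
      case False
      then show ?thesis
        using ip[OF kl(2,1)] corthogonalD[OF ws(2), of l k] kl ws(3) by simp
    qed
    finally show "(\<Sum>i<n. cnj (W $$ (i, k)) * W $$ (i, l)) = (if k = l then 1 else 0)" .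
  qed (simp add: W_def)
  moreover have "W $$ (i, 0) = complex_of_real (1 / sqrt (N 0)) * v $ i" if "i < n" for i
    using that n by (simp add: W_def ws0)
  ultimately show ?thesis
    using that by blast
qed

lemma unitary_block:
  assumes "unitary n V"
  shows "unitary (Suc n) (four_block_mat (1\<^sub>m 1) (0\<^sub>m 1 n) (0\<^sub>m n 1) V)" (is "unitary _ ?B")
proof -
  note c = unitary_carrier[OF assms]
  have a: "adj ?B = four_block_mat (1\<^sub>m 1) (0\<^sub>m 1 n) (0\<^sub>m n 1) (adj V)"
    using c by (intro eq_matI) auto
  have "adj ?B * ?B = 1\<^sub>m (Suc n)"
    unfolding a using c unitary_left[OF assms]
    by (subst mult_four_block_mat[of _ 1 1 _ n _ n _ _ 1 _ n]) (auto intro!: eq_matI)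
  then show ?thesis
    using c unfolding unitary_def by auto
qed

text \<open>Deflation: an eigenvector becomes the first column of a unitary \<open>W\<close>, so
  conjugation by \<open>W\<close> splits off its eigenvalue \<open>e\<close> and leaves a Hermitian
  block of size \<open>n\<close> for the induction. The eigenvalue is real because it is a diagonal
  entry of a Hermitian matrix.\<close>

theorem spectral_exists:
  assumes "M \<in> carrier_mat n n" "adj M = M"
  shows "\<exists>V r. spectral n M V r"
  using assms
proof (induction n arbitrary: M)
  case 0
  then have "spectral 0 M (1\<^sub>m 0) (\<lambda>_. 0)"
    by (auto simp: spectral_def unitary_def intro!: eq_matI)
  then show ?case by blast
next
  case (Suc n)
  note M = Suc.prems(1) and herm = Suc.prems(2)
  obtain as where as: "char_poly M = (\<Prod>a\<leftarrow>as. [:- a, 1:])" "length as = Suc n"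
    using char_poly_factorized[OF M] by blast
  then obtain e where "e \<in> set as" by (cases as) auto
  then have "poly (char_poly M) e = 0"
    unfolding as(1) poly_prod_list by (auto simp: prod_list_zero_iff image_iff)
  then have "eigenvalue M e"
    using eigenvalue_root_char_poly[OF M] by simp
  then obtain v where v: "v \<in> carrier_vec (Suc n)" "v \<noteq> 0\<^sub>v (Suc n)" "M *\<^sub>v v = e \<cdot>\<^sub>v v"
    using M by (auto simp: eigenvalue_def eigenvector_def)
  obtain W c where W: "unitary (Suc n) W" and Wv: "\<And>i. i < Suc n \<Longrightarrow> W $$ (i, 0) = c * v $ i"
    using unitary_with_first_column[OF v(1,2)] by blast
  note cW = unitary_carrier[OF W]
  define M' where "M' = adj W * M * W"
  have M': "M' \<in> carrier_mat (Suc n) (Suc n)"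
    using M cW by (simp add: M'_def)
  have herm': "adj M' = M'"
    unfolding M'_def using M cW herm
    by (simp add: adj_mult[of _ "Suc n" "Suc n" _ "Suc n"]
        assoc_mult_mat[of _ "Suc n" "Suc n" _ "Suc n" _ "Suc n"])
  have MW0: "(M * W) $$ (i, 0) = e * W $$ (i, 0)" if i: "i < Suc n" for i
  proof -
    have "(M * W) $$ (i, 0) = c * (\<Sum>l<Suc n. M $$ (i, l) * v $ l)"
      unfolding sum_distrib_left using M cW i
      by (subst mult_mat_index[of _ "Suc n" "Suc n" _ "Suc n"]) (auto simp: Wv intro!: sum.cong)
    also have "(\<Sum>l<Suc n. M $$ (i, l) * v $ l) = (M *\<^sub>v v) $ i"
      using M v(1) i by (auto simp: scalar_prod_def atLeast0LessThan intro!: sum.cong)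
    finally show ?thesis
      using v i by (simp add: Wv)
  qed
  have M'0: "M' $$ (i, 0) = (if i = 0 then e else 0)" if i: "i < Suc n" for i
  proof -
    have "M' $$ (i, 0) = (adj W * (M * W)) $$ (i, 0)"
      using M cW by (simp add: M'_def assoc_mult_mat[of _ "Suc n" "Suc n" _ "Suc n" _ "Suc n"])
    also have "\<dots> = (\<Sum>l<Suc n. cnj (W $$ (l, i)) * (e * W $$ (l, 0)))"
      using M cW i by (subst mult_mat_index[of _ "Suc n" "Suc n" _ "Suc n"])
        (auto simp del: index_mult_mat(1) simp: MW0 intro!: sum.cong)
    also have "\<dots> = e * (\<Sum>l<Suc n. cnj (W $$ (l, i)) * W $$ (l, 0))"
      unfolding sum_distrib_left by (intro sum.cong) auto
    finally show ?thesis
      using unitary_cols[OF W i, of 0] by simp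
  qed
  have herm_ij: "cnj (M' $$ (j, i)) = M' $$ (i, j)" if "i < Suc n" "j < Suc n" for i j
    using herm' M' that by (metis adj_index carrier_matD)
  have e_real: "e = complex_of_real (Re e)"
    using herm_ij[of 0 0] M'0[of 0] by (simp add: complex_eq_iff)
  define M3 where "M3 = mat n n (\<lambda>(i, j). M' $$ (Suc i, Suc j))"
  have M3: "M3 \<in> carrier_mat n n" "adj M3 = M3"
    using herm_ij by (auto simp: M3_def intro!: eq_matI)
  obtain V r where V: "spectral n M3 V r"
    using Suc.IH[OF M3] by blast
  note uV = spectral_unitary[OF V]
  note cV = unitary_carrier[OF uV]
  define B where "B = four_block_mat (1\<^sub>m 1) (0\<^sub>m 1 n) (0\<^sub>m n 1) V"
  have uB: "unitary (Suc n) B"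
    unfolding B_def by (rule unitary_block[OF uV])
  note cB = unitary_carrier[OF uB]
  define r' where "r' i = (case i of 0 \<Rightarrow> Re e | Suc k \<Rightarrow> r k)" for i
  have "diag_real (Suc n) r' =
      four_block_mat (mat 1 1 (\<lambda>_. e)) (0\<^sub>m 1 n) (0\<^sub>m n 1) (diag_real n r)"
    by (rule eq_matI) (auto simp: r'_def e_real[symmetric] split: nat.splits)
  moreover have "adj B = four_block_mat (1\<^sub>m 1) (0\<^sub>m 1 n) (0\<^sub>m n 1) (adj V)"
    unfolding B_def using cV by (intro eq_matI) auto
  ultimately have "B * diag_real (Suc n) r' * adj B =
      four_block_mat (mat 1 1 (\<lambda>_. e)) (0\<^sub>m 1 n) (0\<^sub>m n 1) (V * diag_real n r * adj V)"
    unfolding B_def using cV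
    by (simp add: mult_four_block_mat[of _ 1 1 _ n _ n _ _ 1 _ n])
  also have "\<dots> = M'"
  proof (rule eq_matI)
    have M3V: "V * diag_real n r * adj V = M3"
      using V by (simp add: spectral_def)
    fix i j assume "i < dim_row M'" "j < dim_col M'"
    then have ij: "i < Suc n" "j < Suc n" using M' by auto
    \<comment> \<open>Being Hermitian turns the vanishing first column into a vanishing first
      row.\<close>
    have "M' $$ (0, j) = (if j = 0 then e else 0)"
      using herm_ij[of 0 j] M'0[of j] ij e_real by (metis complex_cnj_cancel_iff complex_cnj_complex_of_real complex_cnj_zero zero_less_Suc)
    then show "four_block_mat (mat 1 1 (\<lambda>_. e)) (0\<^sub>m 1 n) (0\<^sub>m n 1) (V * diag_real n r * adj V) $$ (i, j) = M' $$ (i, j)"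
      unfolding M3V using ij M3(1) M'0[of i] by (cases i; cases j) (auto simp: M3_def)
  qed (use M' cV in auto)
  finally have M'B: "M' = B * diag_real (Suc n) r' * adj B" by simp
  have "M = (W * adj W) * M * (W * adj W)"
    using M by (simp add: unitary_right[OF W])
  also have "\<dots> = W * M' * adj W"
    unfolding M'_def using M cW by (simp add: assoc_mult_mat[of _ "Suc n" "Suc n" _ "Suc n" _ "Suc n"])
  also have "\<dots> = (W * B) * diag_real (Suc n) r' * adj (W * B)"
    unfolding M'B using cW cB
    by (simp add: adj_mult[OF cW cB] assoc_mult_mat[of _ "Suc n" "Suc n" _ "Suc n" _ "Suc n"])
  finally have "spectral (Suc n) M (W * B) r'"
    using unitary_mult[OF W uB] by (simp add: spectral_def)
  then show ?case by blast
qed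

section \<open>Entrywise form of the spectral decomposition\<close>

lemma spectral_index:
  assumes "spectral n M V r" "i < n" "j < n"
  shows "M $$ (i, j) = (\<Sum>k<n. r k * (V $$ (i, k) * cnj (V $$ (j, k))))"
proof -
  note c = unitary_carrier[OF spectral_unitary[OF assms(1)]]
  have 1: "(V * diag_real n r) $$ (i, k) = V $$ (i, k) * r k" if "k < n" for k
    using c assms that
    by (subst mult_mat_index[of _ n n _ n]) (auto simp: if_distrib[of "\<lambda>x. _ * x"] cong: if_cong)
  have "M $$ (i, j) = ((V * diag_real n r) * adj V) $$ (i, j)"
    using assms by (simp add: spectral_def)
  also have "\<dots> = (\<Sum>k<n. r k * (V $$ (i, k) * cnj (V $$ (j, k))))"
    using c assms
    by (subst mult_mat_index[of _ n n _ n]) (auto simp del: index_mult_mat(1) simp: 1 intro!: sum.cong)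
  finally show ?thesis .
qed

lemma spectralI_index:
  assumes "unitary n V" "M \<in> carrier_mat n n"
    and "\<And>i j. i < n \<Longrightarrow> j < n \<Longrightarrow> M $$ (i, j) = (\<Sum>k<n. r k * (V $$ (i, k) * cnj (V $$ (j, k))))"
  shows "spectral n M V r"
proof -
  have c: "V \<in> carrier_mat n n" using assms by (simp add: unitary_def)
  have s: "spectral n (V * diag_real n r * adj V) V r"
    using assms(1) by (simp add: spectral_def)
  have "M = V * diag_real n r * adj V"
    using assms(2) c by (intro eq_matI) (auto simp: assms(3) spectral_index[OF s] simp del: index_mult_mat(1))
  then show ?thesis
    using s by simp
qed

lemma spectral_eigenvalue:
  assumes "spectral n M V r" "k < n"
  shows "complex_of_real (r k) = (\<Sum>i<n. \<Sum>j<n. cnj (V $$ (i, k)) * M $$ (i, j) * V $$ (j, k))"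
proof -
  note c = unitary_carrier[OF spectral_unitary[OF assms(1)]]
  note M = spectral_carrier[OF assms(1)]
  have "complex_of_real (r k) = (adj V * (M * V)) $$ (k, k)"
    using spectral_diag[OF assms(1)] assms(2) c M assoc_mult_mat[of "adj V" n n M n V n] by simp
  also have "\<dots> = (\<Sum>i<n. cnj (V $$ (i, k)) * (\<Sum>j<n. M $$ (i, j) * V $$ (j, k)))"
    using c M assms(2)
    by (subst mult_mat_index[of _ n n _ n])
      (auto simp del: index_mult_mat(1) simp: mult_mat_index[of M n n V n] intro!: sum.cong)
  finally show ?thesis
    by (simp add: sum_distrib_left mult.assoc)
qed

subsection \<open>Sums over the spectrum\<close>

definition spec_sum :: "(real \<Rightarrow> real) \<Rightarrow> complex mat \<Rightarrow> real" where
  "spec_sum f M = (\<Sum>\<mu>\<in>#eig_mset M. f (Re \<mu>))"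

lemma vn_entropy_spec_sum: "vn_entropy M = - spec_sum (\<lambda>x. x * log 2 x) M"
  by (simp add: vn_entropy_def spec_sum_def)

lemma trace_norm_spec_sum: "trace_norm M = spec_sum sqrt (adj M * M)"
  by (simp add: trace_norm_def spec_sum_def)

text \<open>Both multisets count a root by its order. The library constant is preferred because it
  has rules for products and powers of polynomials.\<close>

lemma eig_mset_proots:
  assumes "M \<in> carrier_mat n n"
  shows "eig_mset M = proots (char_poly M)"
proof -
  have nz: "char_poly M \<noteq> 0"
    using degree_monic_char_poly[OF assms] by auto
  show ?thesis
  proof (rule multiset_eqI)
    fix y
    have "count (eig_mset M) y =
        (\<Sum>x | poly (char_poly M) x = 0. if x = y then Polynomial.order y (char_poly M) else 0)"
      unfolding eig_mset_def count_sum by (intro sum.cong) auto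
    also have "\<dots> = Polynomial.order y (char_poly M)"
      using poly_roots_finite[OF nz] nz by (auto simp: order_root)
    finally show "count (eig_mset M) y = count (proots (char_poly M)) y"
      using nz by simp
  qed
qed

lemma char_poly_spectral:
  assumes "spectral n M V r"
  shows "char_poly M = (\<Prod>k<n. [:- complex_of_real (r k), 1:])"
proof -
  note u = spectral_unitary[OF assms]
  note c = unitary_carrier[OF u]
  have "similar_mat_wit M (diag_real n r) V (adj V)"
    using c spectral_carrier[OF assms] assms
    by (intro similar_mat_witI[of _ _ n]) (auto simp: unitary_left[OF u] unitary_right[OF u] spectral_def)
  then have "char_poly M = char_poly (diag_real n r)"
    by (intro char_poly_similar) (auto simp: similar_mat_def)
  also have "\<dots> = (\<Prod>a\<leftarrow>diag_mat (diag_real n r). [:- a, 1:])"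
    by (rule char_poly_upper_triangular[of _ n]) auto
  also have "diag_mat (diag_real n r) = map (\<lambda>k. complex_of_real (r k)) [0..<n]"
    by (auto simp: diag_mat_def)
  also have "(\<Prod>a\<leftarrow>map (\<lambda>k. complex_of_real (r k)) [0..<n]. [:- a, 1:]) =
      (\<Prod>k<n. [:- complex_of_real (r k), 1:])"
    by (simp add: prod.distinct_set_conv_list[symmetric] comp_def atLeast0LessThan)
  finally show ?thesis .
qed

lemma eig_mset_spectral:
  assumes "spectral n M V r"
  shows "eig_mset M = image_mset (\<lambda>k. complex_of_real (r k)) (mset_set {..<n})"
proof -
  have "eig_mset M = (\<Sum>k<n. {#complex_of_real (r k)#})"
    unfolding eig_mset_proots[OF spectral_carrier[OF assms]] char_poly_spectral[OF assms]
    by (subst proots_prod) auto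
  also have "\<dots> = image_mset (\<lambda>k. complex_of_real (r k)) (mset_set {..<n})"
    by (induction n) (auto simp: lessThan_Suc)
  finally show ?thesis .
qed

lemma spec_sum_spectral:
  assumes "spectral n M V r"
  shows "spec_sum f M = (\<Sum>k<n. f (r k))"
  by (simp add: spec_sum_def eig_mset_spectral[OF assms] image_mset.compositionality comp_def
      sum_unfold_sum_mset)

text \<open>Both sides are the determinant of the block matrix with blocks \<open>x\<close>, \<open>A\<close>, \<open>B\<close>, \<open>1\<close>, computed
  by eliminating \<open>B\<close> from the right and from the left.\<close>

lemma char_poly_mult_commute:
  fixes A B :: "complex mat"
  assumes A: "A \<in> carrier_mat n k" and B: "B \<in> carrier_mat k n"
  shows "[:0, 1:] ^ k * char_poly (A * B) = [:0, 1:] ^ n * char_poly (B * A)"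
proof -
  define x :: "complex poly" where "x = [:0, 1:]"
  interpret h: comm_ring_hom "\<lambda>a :: complex. [:a:]"
    by unfold_locales auto
  define A' where "A' = map_mat (\<lambda>a. [:a:]) A"
  define B' where "B' = map_mat (\<lambda>a. [:a:]) B"
  have A': "A' \<in> carrier_mat n k" and B': "B' \<in> carrier_mat k n"
    using A B by (auto simp: A'_def B'_def)
  have cp: "char_poly (C * D) = det (x \<cdot>\<^sub>m 1\<^sub>m m + - (map_mat (\<lambda>a. [:a:]) C * map_mat (\<lambda>a. [:a:]) D))"
    if "C \<in> carrier_mat m l" "D \<in> carrier_mat l m" for C D m l
  proof -
    have "map_mat (\<lambda>a. [:- a:]) (C * D) = - map_mat (\<lambda>a. [:a:]) (C * D)"
      by (rule eq_matI) auto
    then show ?thesis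
      using that by (simp add: char_poly_def char_poly_matrix_def x_def h.mat_hom_mult[OF that])
  qed
  define P where "P = four_block_mat (x \<cdot>\<^sub>m 1\<^sub>m n) A' B' (1\<^sub>m k)"
  define L where "L = four_block_mat (1\<^sub>m n) (0\<^sub>m n k) (- B') (x \<cdot>\<^sub>m 1\<^sub>m k)"
  define R where "R = four_block_mat (1\<^sub>m n) (0\<^sub>m n k) (- B') (1\<^sub>m k)"
  have P: "P \<in> carrier_mat (n + k) (n + k)" and L: "L \<in> carrier_mat (n + k) (n + k)"
    and R: "R \<in> carrier_mat (n + k) (n + k)"
    using A' B' by (auto simp: P_def L_def R_def)
  have PR: "P * R = four_block_mat (x \<cdot>\<^sub>m 1\<^sub>m n + - (A' * B')) A' (0\<^sub>m k n) (1\<^sub>m k)"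
    unfolding P_def R_def using A' B'
    by (subst mult_four_block_mat[of _ n n _ k _ k _ _ n _ k])
      (auto intro!: cong_four_block_mat)
  have LP: "L * P = four_block_mat (x \<cdot>\<^sub>m 1\<^sub>m n) A' (0\<^sub>m k n) (x \<cdot>\<^sub>m 1\<^sub>m k + - (B' * A'))"
  proof -
    have "- B' * (x \<cdot>\<^sub>m 1\<^sub>m n) + x \<cdot>\<^sub>m 1\<^sub>m k * B' = 0\<^sub>m k n"
      using B' by (intro eq_matI) (auto simp: scalar_prod_def if_distrib[of "\<lambda>y. _ * y"]
          if_distrib[of "\<lambda>y. y * _"] cong: if_cong)
    moreover have "- B' * A' + x \<cdot>\<^sub>m 1\<^sub>m k = x \<cdot>\<^sub>m 1\<^sub>m k + - (B' * A')"
      using A' B' by (intro eq_matI) auto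
    ultimately show ?thesis
      unfolding P_def L_def using A' B'
      by (subst mult_four_block_mat[of _ n n _ k _ k _ _ n _ k])
        (auto intro!: cong_four_block_mat)
  qed
  have "det P = det (P * R)"
    unfolding det_mult[OF P R] unfolding R_def using B'
    by (subst det_four_block_mat_upper_right_zero[of _ n _ k]) auto
  also have "\<dots> = char_poly (A * B)"
    unfolding PR cp[OF A B] using A' B'
    by (subst det_four_block_mat_lower_left_zero[of _ n _ k]) (auto simp: A'_def B'_def)
  finally have 1: "det P = char_poly (A * B)" .
  have "x ^ k * det P = det (L * P)"
    unfolding det_mult[OF L P] unfolding L_def using B'
    by (subst det_four_block_mat_upper_right_zero[of _ n _ k]) auto
  also have "\<dots> = x ^ n * char_poly (B * A)"
    unfolding LP cp[OF B A] using A' B'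
    by (subst det_four_block_mat_lower_left_zero[of _ n _ k]) (auto simp: A'_def B'_def)
  finally show ?thesis
    unfolding 1 x_def .
qed

text \<open>The two characteristic polynomials differ only by powers of the indeterminate, that is,
  by roots at 0, and these contribute \<open>f 0 = 0\<close>.\<close>

lemma spec_sum_mult_commute:
  assumes A: "A \<in> carrier_mat n k" and B: "B \<in> carrier_mat k n" and f0: "f 0 = 0"
  shows "spec_sum f (A * B) = spec_sum f (B * A)"
proof -
  have AB: "A * B \<in> carrier_mat n n" and BA: "B * A \<in> carrier_mat k k"
    using A B by auto
  have nz: "char_poly (A * B) \<noteq> 0" "char_poly (B * A) \<noteq> 0"
    using degree_monic_char_poly[OF AB] degree_monic_char_poly[OF BA] by auto
  have x: "[:0, 1:] ^ m \<noteq> (0 :: complex poly)" for m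
    by simp
  have *: "(\<Sum>\<mu>\<in>#proots ([:0, 1:] ^ m * p). f (Re \<mu>)) = (\<Sum>\<mu>\<in>#proots p. f (Re \<mu>))"
    if "p \<noteq> 0" for m and p :: "complex poly"
  proof -
    have "(\<Sum>\<mu>\<in>#repeat_mset m {#0 :: complex#}. f (Re \<mu>)) = 0"
      using f0 by (induction m) auto
    then show ?thesis
      using that by (subst proots_mult[OF x that]) (simp add: proots_power)
  qed
  show ?thesis
    unfolding spec_sum_def eig_mset_proots[OF AB] eig_mset_proots[OF BA]
    using *[OF nz(1), of k] *[OF nz(2), of n] char_poly_mult_commute[OF A B] by simp
qed

lemma cnj_mult_self: "cnj z * z = (complex_of_real (cmod z))\<^sup>2"
  by (metis complex_norm_square mult.commute of_real_power)

text \<open>A rank-one matrix is a column times a row; in the opposite order the product is the 1 by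
  1 matrix with entry c |v|^2. The scalar allows for the normalisation of conditional
  states.\<close>

lemma spec_sum_scaled_proj_vec:
  assumes f0: "f 0 = 0"
  shows "spec_sum f (complex_of_real c \<cdot>\<^sub>m proj_vec v) = f (c * (\<Sum>i<dim_vec v. (cmod (v $ i))\<^sup>2))"
proof -
  define n where "n = dim_vec v"
  define s where "s = c * (\<Sum>i<n. (cmod (v $ i))\<^sup>2)"
  define A where "A = mat n 1 (\<lambda>(i, _). complex_of_real c * v $ i)"
  define B where "B = mat 1 n (\<lambda>(_, j). cnj (v $ j))"
  have AB: "A \<in> carrier_mat n 1" "B \<in> carrier_mat 1 n"
    by (auto simp: A_def B_def)
  have "complex_of_real c \<cdot>\<^sub>m proj_vec v = A * B"
  proof (rule eq_matI)
    fix i j assume "i < dim_row (A * B)" "j < dim_col (A * B)"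
    then show "(complex_of_real c \<cdot>\<^sub>m proj_vec v) $$ (i, j) = (A * B) $$ (i, j)"
      using mult_mat_index[OF AB, of i j] by (simp add: proj_vec_def n_def[symmetric] A_def B_def)
  qed (auto simp: proj_vec_def n_def A_def B_def)
  moreover have "spectral 1 (B * A) (1\<^sub>m 1) (\<lambda>_. s)"
  proof (rule spectralI_index)
    show "(B * A) $$ (i, j) = (\<Sum>k<1. complex_of_real s * (1\<^sub>m 1 $$ (i, k) * cnj (1\<^sub>m 1 $$ (j, k))))"
      if "i < 1" "j < 1" for i j
    proof -
      have "(B * A) $$ (i, j) = (\<Sum>l<n. complex_of_real (c * (cmod (v $ l))\<^sup>2))"
        using that AB by (subst mult_mat_index[of B 1 n A 1])
          (auto simp: A_def B_def cnj_mult_self intro!: sum.cong)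
      then show ?thesis
        using that by (simp add: s_def sum_distrib_left)
    qed
  qed (use AB in \<open>auto simp: unitary_def\<close>)
  ultimately show ?thesis
    using spec_sum_mult_commute[OF AB, where f = f, OF f0] by (simp add: spec_sum_spectral s_def n_def)
qed

subsection \<open>A qubit coupled to a system of dimension \<open>d\<close>\<close>

lemma sum_lessThan_2_mult:
  fixes f :: "nat \<Rightarrow> 'a :: comm_monoid_add"
  shows "(\<Sum>x<2 * d. f x) = (\<Sum>a<2. \<Sum>b<d. f (a * d + b))"
proof -
  have "(\<Sum>x<2 * d. f x) = (\<Sum>x<d. f x) + (\<Sum>x\<in>{d..<d + d}. f x)"
    by (subst sum.union_disjoint[symmetric]) (auto intro!: sum.cong)
  also have "(\<Sum>x\<in>{d..<d + d}. f x) = (\<Sum>b<d. f (d + b))"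
    using sum.shift_bounds_nat_ivl[of f 0 d d] by (simp add: atLeast0LessThan add.commute)
  finally show ?thesis
    by (simp add: numeral_2_eq_2)
qed

lemma index_less_2_mult [simp]: "a < 2 \<Longrightarrow> b < d \<Longrightarrow> a * d + b < 2 * (d :: nat)"
  by (cases a) auto

lemma div_less_2 [simp]: "x < 2 * d \<Longrightarrow> x div d < (2 :: nat)"
  by (simp add: less_mult_imp_div_less)

lemma mod_less_of_less_2_mult [simp]: "x < 2 * d \<Longrightarrow> x mod d < (d :: nat)"
  by (cases d) auto

text \<open>Column (i, l) is the tensor product of column \<open>i\<close> of \<open>E\<close> with
  column \<open>l\<close> of \<open>F i\<close>: a basis of the second system chosen depending on
  the state of the qubit.\<close>

definition controlled :: "nat \<Rightarrow> complex mat \<Rightarrow> (nat \<Rightarrow> complex mat) \<Rightarrow> complex mat" where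
  "controlled d E F = mat (2 * d) (2 * d)
     (\<lambda>(x, y). E $$ (x div d, y div d) * F (y div d) $$ (x mod d, y mod d))"

lemma controlled_index:
  assumes "a < 2" "b < d" "i < 2" "l < d"
  shows "controlled d E F $$ (a * d + b, i * d + l) = E $$ (a, i) * F i $$ (b, l)"
  using assms by (simp add: controlled_def)

lemma unitary_controlled:
  assumes E: "unitary 2 E" and F: "\<And>i. i < 2 \<Longrightarrow> unitary d (F i)"
  shows "unitary (2 * d) (controlled d E F)"
proof (rule unitaryI_cols)
  fix x y assume xy: "x < 2 * d" "y < 2 * d"
  define i l j m where "i = x div d" and "l = x mod d" and "j = y div d" and "m = y mod d"
  have b: "i < 2" "l < d" "j < 2" "m < d" and x: "x = i * d + l" and y: "y = j * d + m"
    using xy by (auto simp: i_def l_def j_def m_def)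
  have "(\<Sum>z<2 * d. cnj (controlled d E F $$ (z, x)) * controlled d E F $$ (z, y)) =
      (\<Sum>a<2. \<Sum>c<d. (cnj (E $$ (a, i)) * E $$ (a, j)) * (cnj (F i $$ (c, l)) * F j $$ (c, m)))"
    unfolding sum_lessThan_2_mult x y using b
    by (intro sum.cong) (auto simp: controlled_index)
  also have "\<dots> = (if i = j then 1 else 0) * (\<Sum>c<d. cnj (F i $$ (c, l)) * F j $$ (c, m))"
    using unitary_cols[OF E b(1,3)] by (simp add: sum_product[symmetric])
  also have "\<dots> = (if x = y then 1 else 0)"
  proof (cases "i = j")
    case True
    then show ?thesis
      using unitary_cols[OF F b(2,4), of i] b by (auto simp: x y)
  next
    case False
    then show ?thesis
      by (auto simp: i_def j_def)
  qed
  finally show "(\<Sum>z<2 * d. cnj (controlled d E F $$ (z, x)) * controlled d E F $$ (z, y)) =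
      (if x = y then 1 else 0)" .
qed (simp add: controlled_def)

text \<open>\<open>M\<close> is the sum over \<open>i\<close> of |e_i><e_i| tensor
  \<open>T i\<close>, so an eigenbasis of each \<open>T i\<close> can be attached to e_i. Dephased
  states and the squared partial transpose of a pure state both have this shape.\<close>

lemma spectral_controlled:
  assumes E: "unitary 2 E" and F: "\<And>i. i < 2 \<Longrightarrow> spectral d (T i) (F i) (t i)"
    and M: "M \<in> carrier_mat (2 * d) (2 * d)"
    and M_eq: "\<And>a b a' b'. a < 2 \<Longrightarrow> b < d \<Longrightarrow> a' < 2 \<Longrightarrow> b' < d \<Longrightarrow>
      M $$ (a * d + b, a' * d + b') = (\<Sum>i<2. E $$ (a, i) * cnj (E $$ (a', i)) * T i $$ (b, b'))"
  shows "spectral (2 * d) M (controlled d E F) (\<lambda>x. t (x div d) (x mod d))"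
proof (rule spectralI_index)
  show "unitary (2 * d) (controlled d E F)"
    using F by (intro unitary_controlled[OF E]) (auto dest: spectral_unitary)
  fix x y assume xy: "x < 2 * d" "y < 2 * d"
  define a b a' b' where "a = x div d" and "b = x mod d" and "a' = y div d" and "b' = y mod d"
  have ab: "a < 2" "b < d" "a' < 2" "b' < d" and x: "x = a * d + b" and y: "y = a' * d + b'"
    using xy by (auto simp: a_def b_def a'_def b'_def)
  show "M $$ (x, y) = (\<Sum>k<2 * d. complex_of_real (t (k div d) (k mod d)) *
      (controlled d E F $$ (x, k) * cnj (controlled d E F $$ (y, k))))"
    unfolding sum_lessThan_2_mult x y M_eq[OF ab] using ab
    by (intro sum.cong refl)
      (auto simp: controlled_index spectral_index[OF F] sum_distrib_left intro!: sum.cong)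
qed (rule M)

lemma spec_sum_controlled:
  assumes "unitary 2 E" "\<And>i. i < 2 \<Longrightarrow> T i \<in> carrier_mat d d" "\<And>i. i < 2 \<Longrightarrow> adj (T i) = T i"
    and "M \<in> carrier_mat (2 * d) (2 * d)"
    and "\<And>a b a' b'. a < 2 \<Longrightarrow> b < d \<Longrightarrow> a' < 2 \<Longrightarrow> b' < d \<Longrightarrow>
      M $$ (a * d + b, a' * d + b') = (\<Sum>i<2. E $$ (a, i) * cnj (E $$ (a', i)) * T i $$ (b, b'))"
  shows "spec_sum f M = (\<Sum>i<2. spec_sum f (T i))"
proof -
  have "\<forall>i. \<exists>F t. i < 2 \<longrightarrow> spectral d (T i) F t"
    using spectral_exists assms(2,3) by blast
  then obtain F t where F: "\<And>i. i < 2 \<Longrightarrow> spectral d (T i) (F i) (t i)"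
    by metis
  show ?thesis
    by (simp add: spec_sum_spectral[OF spectral_controlled[OF assms(1) F assms(4,5)]]
        spec_sum_spectral[OF F] sum_lessThan_2_mult)
qed

subsection \<open>Traces and partial traces\<close>

lemma mtrace_mult:
  assumes "A \<in> carrier_mat n m" "B \<in> carrier_mat m n"
  shows "mtrace (A * B) = (\<Sum>i<n. \<Sum>j<m. A $$ (i, j) * B $$ (j, i))"
  using assms by (auto simp: mtrace_def mult_mat_index[OF assms] simp del: index_mult_mat(1) intro!: sum.cong)

lemma mtrace_mult_commute:
  assumes "A \<in> carrier_mat n m" "B \<in> carrier_mat m n"
  shows "mtrace (A * B) = mtrace (B * A)"
  unfolding mtrace_mult[OF assms] mtrace_mult[OF assms(2,1)]
  by (subst sum.swap) (simp add: mult.commute)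

lemma mtrace_adj_mult:
  assumes "A \<in> carrier_mat n n" "B \<in> carrier_mat n n"
  shows "mtrace (adj A * B) = (\<Sum>i<n. \<Sum>j<n. cnj (A $$ (i, j)) * B $$ (i, j))"
  using assms by (subst mtrace_mult[of _ n n]) (auto intro!: sum.swap[THEN trans] sum.cong)

lemma mtrace_diag_real [simp]: "mtrace (diag_real n r) = complex_of_real (\<Sum>k<n. r k)"
  by (simp add: mtrace_def)

lemma mtrace_spectral:
  assumes "spectral n M V r"
  shows "mtrace M = complex_of_real (\<Sum>k<n. r k)"
proof -
  note u = spectral_unitary[OF assms]
  note c = unitary_carrier[OF u]
  have "mtrace M = mtrace (adj V * (V * diag_real n r))"
    using assms c mtrace_mult_commute[of "V * diag_real n r" n n "adj V"] by (simp add: spectral_def)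
  then show ?thesis
    using c u by (simp add: assoc_mult_mat[of "adj V" n n V n _ n, symmetric] unitary_left del: assoc_mult_mat)
qed

lemma liftA_carrier [simp]: "liftA P d \<in> carrier_mat (2 * d) (2 * d)"
  by (simp add: liftA_def)

lemma liftA_index:
  assumes "a < 2" "b < d" "a' < 2" "b' < d"
  shows "liftA P d $$ (a * d + b, a' * d + b') = (if b = b' then P $$ (a, a') else 0)"
  using assms by (simp add: liftA_def)

lemma eq_mat_2_multI:
  assumes "A \<in> carrier_mat (2 * d) (2 * d)" "B \<in> carrier_mat (2 * d) (2 * d)"
    and eq: "\<And>a b a' b'. a < 2 \<Longrightarrow> b < d \<Longrightarrow> a' < 2 \<Longrightarrow> b' < d \<Longrightarrow>
      A $$ (a * d + b, a' * d + b') = B $$ (a * d + b, a' * d + b')"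
  shows "A = B"
proof (rule eq_matI)
  fix x y assume "x < dim_row B" "y < dim_col B"
  then have "x < 2 * d" "y < 2 * d" using assms by auto
  then show "A $$ (x, y) = B $$ (x, y)"
    using eq[of "x div d" "x mod d" "y div d" "y mod d"] by simp
qed (use assms in auto)

lemma liftA_mult:
  assumes "P \<in> carrier_mat 2 2" "Q \<in> carrier_mat 2 2"
  shows "liftA (P * Q) d = liftA P d * liftA Q d"
proof (rule eq_mat_2_multI)
  fix a b a' b' :: nat assume ab: "a < 2" "b < d" "a' < 2" "b' < d"
  have "(liftA P d * liftA Q d) $$ (a * d + b, a' * d + b') =
      (\<Sum>c<2. \<Sum>e<d. (if b = e then P $$ (a, c) else 0) * (if e = b' then Q $$ (c, a') else 0))"
    using ab by (subst mult_mat_index[of _ "2 * d" "2 * d" _ "2 * d"])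
      (auto simp: sum_lessThan_2_mult liftA_index intro!: sum.cong)
  also have "\<dots> = (\<Sum>c<2. if b = b' then P $$ (a, c) * Q $$ (c, a') else 0)"
    using ab by (intro sum.cong) (auto simp: if_distrib[of "\<lambda>y. y * _"] cong: if_cong)
  also have "\<dots> = liftA (P * Q) d $$ (a * d + b, a' * d + b')"
    using ab assms by (simp add: liftA_index mult_mat_index[OF assms] del: index_mult_mat(1))
  finally show "liftA (P * Q) d $$ (a * d + b, a' * d + b') =
      (liftA P d * liftA Q d) $$ (a * d + b, a' * d + b')" ..
qed auto

lemma adj_liftA:
  assumes "P \<in> carrier_mat 2 2"
  shows "adj (liftA P d) = liftA (adj P) d"
  using assms by (intro eq_mat_2_multI) (auto simp: liftA_index carrier_matD[OF liftA_carrier])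

lemma ptrace_B_carrier: "ptrace_B rho \<in> carrier_mat 2 2"
  by (simp add: ptrace_B_def Let_def)

lemma ptrace_B_index:
  assumes "rho \<in> carrier_mat (2 * d) (2 * d)" "a < 2" "a' < 2"
  shows "ptrace_B rho $$ (a, a') = (\<Sum>b<d. rho $$ (a * d + b, a' * d + b))"
  using assms by (simp add: ptrace_B_def Let_def)

text \<open>The duality that characterises the partial trace; it moves test operators between the
  qubit and the joint system.\<close>

lemma mtrace_liftA_mult:
  assumes "Z \<in> carrier_mat 2 2" "rho \<in> carrier_mat (2 * d) (2 * d)"
  shows "mtrace (liftA Z d * rho) = mtrace (Z * ptrace_B rho)"
proof -
  have "mtrace (liftA Z d * rho) =
      (\<Sum>a<2. \<Sum>b<d. \<Sum>a'<2. \<Sum>b'<d. (if b = b' then Z $$ (a, a') else 0) * rho $$ (a' * d + b', a * d + b))"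
    using assms by (subst mtrace_mult[of _ "2 * d" "2 * d"])
      (auto simp: sum_lessThan_2_mult liftA_index intro!: sum.cong)
  also have "\<dots> = (\<Sum>a<2. \<Sum>b<d. \<Sum>a'<2. Z $$ (a, a') * rho $$ (a' * d + b, a * d + b))"
    by (intro sum.cong refl) (simp add: if_distrib[of "\<lambda>y. y * _"] cong: if_cong)
  also have "\<dots> = (\<Sum>a<2. \<Sum>a'<2. Z $$ (a, a') * ptrace_B rho $$ (a', a))"
    using assms by (simp add: ptrace_B_index sum_distrib_left sum.swap[of _ "{..<d}"])
  also have "\<dots> = mtrace (Z * ptrace_B rho)"
    using assms by (subst mtrace_mult[of _ 2 2]) (auto simp: ptrace_B_carrier)
  finally show ?thesis .
qed

lemma mtrace_ptrace_B:
  assumes "rho \<in> carrier_mat (2 * d) (2 * d)"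
  shows "mtrace (ptrace_B rho) = mtrace rho"
  using assms carrier_matD[OF ptrace_B_carrier[of rho]]
  by (simp add: mtrace_def ptrace_B_index sum_lessThan_2_mult)

subsection \<open>Monotonicity of the relative entropy under the partial trace\<close>

text \<open>For \<open>t > 0\<close> the maximum of \<open>res_form\<close> over all \<open>X\<close> is \<open>res_sum\<close>, the trace of
  \<open>rho (L_sigma + t R_rho)\<^sup>-\<^sup>1 rho\<close> for left and right multiplication \<open>L\<close>, \<open>R\<close>. Testing with
  \<open>X \<otimes> 1\<close> shows that this maximum can only decrease under the partial trace.\<close>

definition res_form :: "real \<Rightarrow> complex mat \<Rightarrow> complex mat \<Rightarrow> complex mat \<Rightarrow> real" where
  "res_form t rho sigma X = 2 * Re (mtrace (adj X * rho)) - Re (mtrace (X * adj X * sigma))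
     - t * Re (mtrace (adj X * X * rho))"

text \<open>Tensoring with the identity respects products and adjoints, so each trace in the form is
  the trace of a lifted operator against a state and passes to the reduced state.\<close>

lemma res_form_liftA:
  assumes "X \<in> carrier_mat 2 2" "rho \<in> carrier_mat (2 * d) (2 * d)" "sigma \<in> carrier_mat (2 * d) (2 * d)"
  shows "res_form t rho sigma (liftA X d) = res_form t (ptrace_B rho) (ptrace_B sigma) X"
  using assms by (simp add: res_form_def adj_liftA liftA_mult[symmetric] mtrace_liftA_mult)

text \<open>Written in the eigenbases of \<open>sigma\<close> (rows) and \<open>rho\<close>
  (columns), left multiplication by \<open>sigma\<close> and right multiplication by
  \<open>rho\<close> become diagonal. The form then decouples into one quadratic function for each
  entry of \<open>Y\<close>.\<close>

lemma res_form_spectral: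
  assumes rho: "spectral n rho V r" and sigma: "spectral n sigma W s" and X: "X \<in> carrier_mat n n"
  defines "Y \<equiv> adj W * X * V" and "U \<equiv> adj W * V"
  shows "res_form t rho sigma X = (\<Sum>j<n. \<Sum>k<n.
    2 * r k * Re (cnj (Y $$ (j, k)) * U $$ (j, k)) - (s j + t * r k) * (cmod (Y $$ (j, k)))\<^sup>2)"
proof -
  note uV = spectral_unitary[OF rho] and uW = spectral_unitary[OF sigma]
  note cV = unitary_carrier[OF uV] and cW = unitary_carrier[OF uW]
  note assoc = assoc_mult_mat[of _ n n _ n _ n]
  have Y: "Y \<in> carrier_mat n n" and U: "U \<in> carrier_mat n n"
    using cV cW X by (auto simp: Y_def U_def)
  have adjY: "adj Y = adj V * adj X * W"
    using cV cW X by (simp add: Y_def adj_mult[of _ n n _ n] assoc)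
  have WW: "W * (adj W * A) = A" if "A \<in> carrier_mat n n" for A
    using that cW assoc[of W "adj W" A] by (simp add: unitary_right[OF uW])
  have VV: "V * (adj V * A) = A" if "A \<in> carrier_mat n n" for A
    using that cV assoc[of V "adj V" A] by (simp add: unitary_right[OF uV])
  have cyc: "mtrace (adj V * A) = mtrace (A * adj V)" if "A \<in> carrier_mat n n" for A
    using that cV by (intro mtrace_mult_commute[of _ n n]) auto
  have UD: "(U * diag_real n r) $$ (j, k) = U $$ (j, k) * r k" if "j < n" "k < n" for j k
    using U that
    by (subst mult_mat_index[of _ n n _ n]) (auto simp: if_distrib[of "\<lambda>x. _ * x"] cong: if_cong)
  have YD: "(Y * diag_real n r) $$ (j, k) = Y $$ (j, k) * r k" if "j < n" "k < n" for j k
    using Y that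
    by (subst mult_mat_index[of _ n n _ n]) (auto simp: if_distrib[of "\<lambda>x. _ * x"] cong: if_cong)
  have DY: "(diag_real n s * Y) $$ (j, k) = s j * Y $$ (j, k)" if "j < n" "k < n" for j k
    using Y that
    by (subst mult_mat_index[of _ n n _ n]) (auto simp: if_distrib[of "\<lambda>x. x * _"] cong: if_cong)
  have "mtrace (adj X * rho) = mtrace (adj Y * (U * diag_real n r))"
    using rho cV cW X unfolding adjY U_def
    by (simp add: spectral_def assoc WW VV cyc)
  then have 1: "mtrace (adj X * rho) = (\<Sum>j<n. \<Sum>k<n. cnj (Y $$ (j, k)) * (U $$ (j, k) * r k))"
    using Y U by (simp add: mtrace_adj_mult UD del: index_mult_mat(1))
  have "mtrace (X * adj X * sigma) = mtrace (X * (adj X * sigma))"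
    using X spectral_carrier[OF sigma] by (simp add: assoc)
  also have "\<dots> = mtrace (adj X * sigma * X)"
    using X spectral_carrier[OF sigma] by (intro mtrace_mult_commute[of _ n n]) auto
  also have "\<dots> = mtrace (adj Y * (diag_real n s * Y))"
    using sigma cV cW X unfolding adjY unfolding Y_def
    by (simp add: spectral_def assoc WW VV cyc unitary_right[OF uV])
  finally have 2: "mtrace (X * adj X * sigma) = (\<Sum>j<n. \<Sum>k<n. cnj (Y $$ (j, k)) * (s j * Y $$ (j, k)))"
    using Y by (simp add: mtrace_adj_mult DY del: index_mult_mat(1))
  have "mtrace (adj X * X * rho) = mtrace (adj Y * (Y * diag_real n r))"
    using rho cV cW X unfolding adjY unfolding Y_def
    by (simp add: spectral_def assoc WW VV cyc)
  then have 3: "mtrace (adj X * X * rho) = (\<Sum>j<n. \<Sum>k<n. cnj (Y $$ (j, k)) * (Y $$ (j, k) * r k))"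
    using Y by (simp add: mtrace_adj_mult YD del: index_mult_mat(1))
  have *: "2 * r k * Re (cnj y * u) - (s j + t * r k) * (cmod y)\<^sup>2 =
      2 * Re (cnj y * (u * r k)) - Re (cnj y * (s j * y)) - t * Re (cnj y * (y * r k))" for j k and y u :: complex
    unfolding cmod_power2 by (simp add: power2_eq_square algebra_simps)
  show ?thesis
    unfolding res_form_def 1 2 3 * by (simp only: Re_sum sum_subtractf sum_distrib_left)
qed

text \<open>The transition probabilities between two orthonormal bases; for unitary arguments they
  form a doubly stochastic matrix.\<close>

definition overlap :: "complex mat \<Rightarrow> complex mat \<Rightarrow> nat \<Rightarrow> nat \<Rightarrow> real" where
  "overlap W V j k = (cmod ((adj W * V) $$ (j, k)))\<^sup>2"

lemma overlap_nonneg [simp]: "overlap W V j k \<ge> 0"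
  by (simp add: overlap_def)

lemma sum_overlap_left:
  assumes "unitary n W" "unitary n V" "k < n"
  shows "(\<Sum>j<n. overlap W V j k) = 1"
proof -
  have "complex_of_real (\<Sum>j<n. overlap W V j k) = 1"
    using unitary_cols[OF unitary_mult[OF unitary_adj[OF assms(1)] assms(2)] assms(3,3)]
    by (simp add: overlap_def cnj_mult_self)
  then show ?thesis
    by (simp only: of_real_eq_1_iff)
qed

lemma overlap_commute:
  assumes "unitary n W" "unitary n V" "j < n" "k < n"
  shows "overlap W V j k = overlap V W k j"
proof -
  note c = unitary_carrier[OF assms(1)] unitary_carrier[OF assms(2)]
  have "adj W * V = adj (adj V * W)"
    using c by (simp add: adj_mult[of _ n n _ n])
  then show ?thesis
    using c assms(3,4) by (simp add: overlap_def del: index_mult_mat(1))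
qed

lemma sum_overlap_right:
  assumes "unitary n W" "unitary n V" "j < n"
  shows "(\<Sum>k<n. overlap W V j k) = 1"
  using sum_overlap_left[OF assms(2,1,3)] overlap_commute[OF assms(1,2,3)] by simp

definition res_sum :: "nat \<Rightarrow> (nat \<Rightarrow> nat \<Rightarrow> real) \<Rightarrow> (nat \<Rightarrow> real) \<Rightarrow> (nat \<Rightarrow> real) \<Rightarrow> real \<Rightarrow> real" where
  "res_sum n w r s t = (\<Sum>j<n. \<Sum>k<n. w j k * (r k)\<^sup>2 / (s j + t * r k))"

text \<open>Entry by entry this is completing the square: 2 r Re(cnj y u) - q |y|^2 is at most |u|^2
  r^2 / q.\<close>

lemma res_form_le:
  assumes rho: "spectral n rho V r" and sigma: "spectral n sigma W s" and X: "X \<in> carrier_mat n n"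
    and nn: "\<And>k. k < n \<Longrightarrow> r k \<ge> 0" "\<And>k. k < n \<Longrightarrow> s k \<ge> 0" and t: "t > 0"
  shows "res_form t rho sigma X \<le> res_sum n (overlap W V) r s t"
  unfolding res_form_spectral[OF assms(1-3)] res_sum_def
proof (intro sum_mono)
  fix j k assume "j \<in> {..<n}" "k \<in> {..<n}"
  then have r: "r k \<ge> 0" and s: "s j \<ge> 0" using nn by auto
  define q y u where "q = s j + t * r k" and "y = (adj W * X * V) $$ (j, k)" and "u = (adj W * V) $$ (j, k)"
  have "2 * r k * Re (cnj y * u) - q * (cmod y)\<^sup>2 \<le> (cmod u)\<^sup>2 * (r k)\<^sup>2 / q"
  proof (cases "q = 0")
    \<comment> \<open>A vanishing denominator forces \<open>r k = 0\<close>. Then both sides are 0,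
      the right one also by the convention for division by zero.\<close>
    case True
    then have "t * r k = 0"
      using r s t mult_nonneg_nonneg[of t "r k"] unfolding q_def by linarith
    then show ?thesis
      using True t by simp
  next
    case False
    then have q: "q > 0"
      using r s t mult_nonneg_nonneg[of t "r k"] unfolding q_def by linarith
    have "Re (cnj y * u) \<le> cmod y * cmod u"
      by (metis complex_Re_le_cmod complex_mod_cnj norm_mult)
    then have "2 * r k * Re (cnj y * u) \<le> 2 * r k * (cmod y * cmod u)"
      using r by (intro mult_left_mono) auto
    moreover have "0 \<le> (q * cmod y - r k * cmod u)\<^sup>2 / q"
      using q by simp
    moreover have "(q * cmod y - r k * cmod u)\<^sup>2 / q =
        q * (cmod y)\<^sup>2 - 2 * r k * (cmod y * cmod u) + (cmod u)\<^sup>2 * (r k)\<^sup>2 / q"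
      using q by (simp add: field_simps power2_eq_square)
    ultimately show ?thesis by linarith
  qed
  then show "2 * r k * Re (cnj ((adj W * X * V) $$ (j, k)) * (adj W * V) $$ (j, k)) -
      (s j + t * r k) * (cmod ((adj W * X * V) $$ (j, k)))\<^sup>2 \<le> overlap W V j k * (r k)\<^sup>2 / (s j + t * r k)"
    by (simp add: q_def y_def u_def overlap_def del: index_mult_mat(1))
qed

text \<open>The stationary point of each entrywise quadratic, y = u r / q, is transported back from
  the eigenbases. For q = 0 division by zero gives y = 0, and both sides vanish.\<close>

lemma res_form_attained:
  assumes rho: "spectral n rho V r" and sigma: "spectral n sigma W s"
  shows "\<exists>X\<in>carrier_mat n n. res_form t rho sigma X = res_sum n (overlap W V) r s t"
proof -
  note uV = spectral_unitary[OF rho] and uW = spectral_unitary[OF sigma]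
  note cV = unitary_carrier[OF uV] and cW = unitary_carrier[OF uW]
  define U where "U = adj W * V"
  define Y where "Y = mat n n (\<lambda>(j, k). U $$ (j, k) * complex_of_real (r k / (s j + t * r k)))"
  define X where "X = W * Y * adj V"
  have Y: "Y \<in> carrier_mat n n" by (simp add: Y_def)
  have X: "X \<in> carrier_mat n n" using cV cW Y by (simp add: X_def)
  have "adj W * X * V = (adj W * W) * Y * (adj V * V)"
    unfolding X_def using cV cW Y by (simp add: assoc_mult_mat[of _ n n _ n _ n])
  then have "adj W * X * V = Y"
    using Y by (simp add: unitary_left[OF uV] unitary_left[OF uW])
  moreover have "2 * r k * Re (cnj (Y $$ (j, k)) * U $$ (j, k)) - (s j + t * r k) * (cmod (Y $$ (j, k)))\<^sup>2
      = (cmod (U $$ (j, k)))\<^sup>2 * (r k)\<^sup>2 / (s j + t * r k)" if "j < n" "k < n" for j k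
  proof -
    define c where "c = r k / (s j + t * r k)"
    have Yc: "Y $$ (j, k) = U $$ (j, k) * complex_of_real c"
      using that by (simp add: Y_def c_def)
    have "Re (cnj (Y $$ (j, k)) * U $$ (j, k)) = c * (cmod (U $$ (j, k)))\<^sup>2"
      unfolding Yc cmod_power2 by (simp add: power2_eq_square algebra_simps)
    moreover have "(cmod (Y $$ (j, k)))\<^sup>2 = c\<^sup>2 * (cmod (U $$ (j, k)))\<^sup>2"
      unfolding Yc by (simp add: norm_mult power_mult_distrib)
    moreover have "2 * r k * (c * m) - (s j + t * r k) * (c\<^sup>2 * m) = m * (r k)\<^sup>2 / (s j + t * r k)" for m
      by (cases "s j + t * r k = 0") (auto simp: c_def power2_eq_square diff_divide_distrib[symmetric])
    ultimately show ?thesis by simp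
  qed
  ultimately have "res_form t rho sigma X = res_sum n (overlap W V) r s t"
    unfolding res_form_spectral[OF rho sigma X] res_sum_def overlap_def U_def[symmetric] by simp
  then show ?thesis using X by blast
qed

text \<open>An antiderivative of \<open>res_sum\<close> in \<open>t\<close>, under the condition
  defined next.\<close>

definition log_sum :: "nat \<Rightarrow> (nat \<Rightarrow> nat \<Rightarrow> real) \<Rightarrow> (nat \<Rightarrow> real) \<Rightarrow> (nat \<Rightarrow> real) \<Rightarrow> real \<Rightarrow> real" where
  "log_sum n w r s t = (\<Sum>j<n. \<Sum>k<n. w j k * r k * ln (s j + t * r k))"

text \<open>Models \<open>s\<close> as the diagonal, in another orthonormal basis, of a positive
  operator with spectrum \<open>r\<close>, where \<open>w\<close> holds the transition
  probabilities. It makes the cross term of the relative entropy collapse to a sum over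
  \<open>s\<close> alone.\<close>

definition stochastic_image :: "nat \<Rightarrow> (nat \<Rightarrow> nat \<Rightarrow> real) \<Rightarrow> (nat \<Rightarrow> real) \<Rightarrow> (nat \<Rightarrow> real) \<Rightarrow> bool" where
  "stochastic_image n w r s \<longleftrightarrow> (\<forall>j<n. \<forall>k<n. w j k \<ge> 0) \<and> (\<forall>k<n. r k \<ge> 0) \<and>
     (\<forall>j<n. s j = (\<Sum>k<n. w j k * r k)) \<and> (\<forall>k<n. (\<Sum>j<n. w j k) = 1)"

text \<open>The support condition for finite relative entropy: \<open>s j\<close> is a sum of
  nonnegative terms, hence at least \<open>w j k * r k\<close>. So no logarithm at 0 enters with
  nonzero weight.\<close>

lemma stochastic_image_pos:
  assumes "stochastic_image n w r s" "j < n" "k < n"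
  shows "w j k * r k = 0 \<or> (r k > 0 \<and> s j > 0)"
proof (cases "w j k * r k = 0")
  case False
  have nn: "w j i * r i \<ge> 0" if "i < n" for i
    using assms that by (auto simp: stochastic_image_def)
  have "w j k * r k \<le> (\<Sum>i<n. w j i * r i)"
    using assms(3) nn by (intro member_le_sum) auto
  then have "w j k * r k \<le> s j"
    using assms by (simp add: stochastic_image_def)
  moreover have "w j k * r k > 0" using False nn[OF assms(3)] by linarith
  moreover have "r k \<ge> 0" using assms by (auto simp: stochastic_image_def)
  ultimately show ?thesis
    using False by (cases "r k = 0") auto
qed simp

lemma log_sum_0:
  assumes "stochastic_image n w r s"
  shows "log_sum n w r s 0 = (\<Sum>j<n. s j * ln (s j))"
  using assms by (auto simp: log_sum_def stochastic_image_def sum_distrib_right)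

lemma log_sum_DERIV:
  assumes S: "stochastic_image n w r s" and t: "t \<ge> 0"
  shows "(log_sum n w r s has_real_derivative res_sum n w r s t) (at t)"
  unfolding log_sum_def[abs_def] res_sum_def
proof (intro DERIV_sum)
  fix j k assume jk: "j \<in> {..<n}" "k \<in> {..<n}"
  show "((\<lambda>t. w j k * r k * ln (s j + t * r k)) has_real_derivative
      w j k * (r k)\<^sup>2 / (s j + t * r k)) (at t)"
  proof (cases "w j k * r k = 0")
    case True
    then show ?thesis by auto
  next
    case False
    then have "r k > 0" "s j > 0"
      using stochastic_image_pos[OF S, of j k] jk by auto
    then have "s j + t * r k > 0"
      using t by (intro add_pos_nonneg) auto
    then show ?thesis
      by (auto intro!: derivative_eq_intros simp: power2_eq_square field_simps)
  qed
qed

text \<open>For terms of nonzero weight, ln (s + t r) - ln t = ln (s / t + r) tends to ln r; the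
  column sums of \<open>w\<close> then remove the index \<open>j\<close>.\<close>

lemma log_sum_at_top:
  assumes S: "stochastic_image n w r s"
  shows "((\<lambda>t. log_sum n w r s t - (\<Sum>k<n. r k) * ln t) \<longlongrightarrow> (\<Sum>k<n. r k * ln (r k))) at_top"
proof -
  have col: "(\<Sum>j<n. \<Sum>k<n. w j k * r k * x k) = (\<Sum>k<n. r k * x k)" for x
  proof -
    have "(\<Sum>j<n. \<Sum>k<n. w j k * r k * x k) = (\<Sum>k<n. (\<Sum>j<n. w j k) * (r k * x k))"
      by (subst sum.swap) (simp add: sum_distrib_right mult.assoc)
    then show ?thesis
      using S by (simp add: stochastic_image_def)
  qed
  have "((\<lambda>t. \<Sum>j<n. \<Sum>k<n. w j k * r k * (ln (s j + t * r k) - ln t)) \<longlongrightarrow>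
      (\<Sum>j<n. \<Sum>k<n. w j k * r k * ln (r k))) at_top"
  proof (intro tendsto_sum)
    fix j k assume jk: "j \<in> {..<n}" "k \<in> {..<n}"
    show "((\<lambda>t. w j k * r k * (ln (s j + t * r k) - ln t)) \<longlongrightarrow> w j k * r k * ln (r k)) at_top"
    proof (cases "w j k * r k = 0")
      case False
      then have pos: "r k > 0" "s j > 0"
        using stochastic_image_pos[OF S, of j k] jk by auto
      have "((\<lambda>t. s j / t + r k) \<longlongrightarrow> 0 + r k) at_top"
        by (intro tendsto_intros tendsto_divide_0[OF tendsto_const] filterlim_at_top_imp_at_infinity filterlim_ident)
      then have "((\<lambda>t. ln (s j / t + r k)) \<longlongrightarrow> ln (r k)) at_top"
        using pos by (intro tendsto_ln) auto
      moreover have "\<forall>\<^sub>F t in at_top. ln (s j / t + r k) = ln (s j + t * r k) - ln t"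
        using eventually_gt_at_top[of 0]
      proof eventually_elim
        case (elim t)
        then have "s j / t + r k = (s j + t * r k) / t" by (simp add: field_simps)
        then show ?case
          using elim pos add_pos_pos[of "s j" "t * r k"] by (simp add: ln_div)
      qed
      ultimately have "((\<lambda>t. ln (s j + t * r k) - ln t) \<longlongrightarrow> ln (r k)) at_top"
        by (rule Lim_transform_eventually)
      then show ?thesis
        by (rule tendsto_mult_left)
    qed auto
  qed
  moreover have "(\<Sum>j<n. \<Sum>k<n. w j k * r k * (ln (s j + t * r k) - ln t)) =
      log_sum n w r s t - (\<Sum>k<n. r k) * ln t" for t
    using col[of "\<lambda>_. ln t"] by (simp add: log_sum_def right_diff_distrib sum_subtractf sum_distrib_right)
  ultimately show ?thesis
    by (simp add: col)
qed

text \<open>\<open>\<Sum> r ln r - \<Sum> s ln s\<close> is the total increment of \<open>log_sum\<close> over \<open>(0, \<infinity>)\<close>, up to a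
  term that depends on \<open>\<Sum> r\<close> only, so that it suffices to compare derivatives.\<close>

lemma entropy_gain_mono:
  assumes S: "stochastic_image n w r s" and S': "stochastic_image n' w' r' s'"
    and tr: "(\<Sum>k<n. r k) = (\<Sum>k<n'. r' k)"
    and le: "\<And>t. t > 0 \<Longrightarrow> res_sum n' w' r' s' t \<le> res_sum n w r s t"
  shows "(\<Sum>k<n'. r' k * ln (r' k)) - (\<Sum>k<n'. s' k * ln (s' k)) \<le>
    (\<Sum>k<n. r k * ln (r k)) - (\<Sum>k<n. s k * ln (s k))"
proof -
  define \<Phi> where "\<Phi> t = log_sum n w r s t - log_sum n' w' r' s' t" for t
  have D: "(\<Phi> has_real_derivative res_sum n w r s t - res_sum n' w' r' s' t) (at t)" if "t \<ge> 0" for t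
    unfolding \<Phi>_def[abs_def] using that by (intro DERIV_diff log_sum_DERIV S S')
  have mono: "\<Phi> 0 \<le> \<Phi> t" if "t > 0" for t
  proof (rule DERIV_nonneg_imp_increasing_open[of 0 t])
    show "\<exists>y. (\<Phi> has_real_derivative y) (at x) \<and> 0 \<le> y" if "0 < x" "x < t" for x
      using D[of x] le[of x] that by (intro exI[of _ "res_sum n w r s x - res_sum n' w' r' s' x"]) auto
    show "continuous_on {0..t} \<Phi>"
      using D by (intro continuous_at_imp_continuous_on ballI DERIV_isCont) auto
  qed (use that in auto)
  have "((\<lambda>t. (log_sum n w r s t - (\<Sum>k<n. r k) * ln t) - (log_sum n' w' r' s' t - (\<Sum>k<n'. r' k) * ln t))
      \<longlongrightarrow> (\<Sum>k<n. r k * ln (r k)) - (\<Sum>k<n'. r' k * ln (r' k))) at_top"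
    by (intro tendsto_diff log_sum_at_top S S')
  \<comment> \<open>Equal traces cancel the two divergent \<open>ln t\<close> terms, so
    \<open>\<Phi>\<close> itself converges.\<close>
  then have "(\<Phi> \<longlongrightarrow> (\<Sum>k<n. r k * ln (r k)) - (\<Sum>k<n'. r' k * ln (r' k))) at_top"
    by (simp add: tr \<Phi>_def[abs_def])
  then have "\<Phi> 0 \<le> (\<Sum>k<n. r k * ln (r k)) - (\<Sum>k<n'. r' k * ln (r' k))"
    by (rule tendsto_lowerbound) (auto intro: eventually_mono[OF eventually_gt_at_top[of 0]] mono)
  then show ?thesis
    by (simp add: \<Phi>_def log_sum_0[OF S] log_sum_0[OF S'])
qed

text \<open>Inserting the spectral decomposition of \<open>rho\<close> gives <w_j|rho|w_j> as the
  sum over k of r_k |<w_j|v_k>|^2.\<close>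

lemma stochastic_image_overlap:
  assumes rho: "spectral n rho V r" and W: "unitary n W" and nn: "\<And>k. k < n \<Longrightarrow> r k \<ge> 0"
    and diag: "\<And>j. j < n \<Longrightarrow> complex_of_real (s j) =
      (\<Sum>i<n. \<Sum>i'<n. cnj (W $$ (i, j)) * rho $$ (i, i') * W $$ (i', j))"
  shows "stochastic_image n (overlap W V) r s"
proof -
  note V = spectral_unitary[OF rho]
  note c = unitary_carrier[OF W] unitary_carrier[OF V]
  have "s j = (\<Sum>k<n. overlap W V j k * r k)" if j: "j < n" for j
  proof -
    have U: "(adj W * V) $$ (j, k) = (\<Sum>i<n. cnj (W $$ (i, j)) * V $$ (i, k))" if "k < n" for k
      using c j that by (subst mult_mat_index[of _ n n _ n]) (auto intro!: sum.cong)
    have ov: "complex_of_real (overlap W V j k) =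
        (\<Sum>i<n. \<Sum>i'<n. cnj (W $$ (i, j)) * V $$ (i, k) * (cnj (V $$ (i', k)) * W $$ (i', j)))"
      if "k < n" for k
      unfolding overlap_def complex_norm_square U[OF that] cnj_sum sum_product by (simp add: mult.commute)
    have "complex_of_real (s j) =
        (\<Sum>i<n. \<Sum>i'<n. \<Sum>k<n. cnj (W $$ (i, j)) * (r k * (V $$ (i, k) * cnj (V $$ (i', k)))) * W $$ (i', j))"
      unfolding diag[OF j]
      by (intro sum.cong refl) (auto simp: spectral_index[OF rho] sum_distrib_left sum_distrib_right)
    also have "\<dots> = (\<Sum>k<n. \<Sum>i<n. \<Sum>i'<n. cnj (W $$ (i, j)) * (r k * (V $$ (i, k) * cnj (V $$ (i', k)))) * W $$ (i', j))"
      by (subst sum.swap[symmetric], intro sum.cong refl sum.swap)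
    also have "\<dots> = (\<Sum>k<n. complex_of_real (overlap W V j k) * r k)"
      by (intro sum.cong refl) (simp add: ov sum_distrib_left sum_distrib_right mult_ac)
    also have "\<dots> = complex_of_real (\<Sum>k<n. overlap W V j k * r k)"
      by simp
    finally show ?thesis
      by (simp only: of_real_eq_iff)
  qed
  then show ?thesis
    using nn sum_overlap_left[OF W V] by (auto simp: stochastic_image_def)
qed

text \<open>Under \<open>S\<close> and \<open>SA\<close> the two sides are D(rho_A || sigma_A) and
  D(rho || sigma). For each \<open>t\<close>, the optimal operator of the reduced pair, tensored
  with the identity, is a competitor of the same value for the joint pair.\<close>

theorem relative_entropy_ptrace_B:
  assumes rho: "spectral (2 * d) rho V r" and sigma: "spectral (2 * d) sigma W s"
    and rhoA: "spectral 2 (ptrace_B rho) E a" and sigmaA: "spectral 2 (ptrace_B sigma) U p"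
    and S: "stochastic_image (2 * d) (overlap W V) r s" and SA: "stochastic_image 2 (overlap U E) a p"
  shows "(\<Sum>k<2. a k * ln (a k)) - (\<Sum>k<2. p k * ln (p k)) \<le>
    (\<Sum>k<2 * d. r k * ln (r k)) - (\<Sum>k<2 * d. s k * ln (s k))"
proof (rule entropy_gain_mono[OF S SA])
  have "complex_of_real (\<Sum>k<2 * d. r k) = complex_of_real (\<Sum>k<2. a k)"
    using mtrace_ptrace_B[OF spectral_carrier[OF rho]] mtrace_spectral[OF rho] mtrace_spectral[OF rhoA] by simp
  then show "(\<Sum>k<2 * d. r k) = (\<Sum>k<2. a k)"
    by (simp only: of_real_eq_iff)
  fix t :: real assume t: "t > 0"
  have nn: "r k \<ge> 0" "s k \<ge> 0" if "k < 2 * d" for k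
    using S that by (auto simp: stochastic_image_def intro!: sum_nonneg)
  obtain X where X: "X \<in> carrier_mat 2 2"
    "res_form t (ptrace_B rho) (ptrace_B sigma) X = res_sum 2 (overlap U E) a p t"
    using res_form_attained[OF rhoA sigmaA] by blast
  have "res_form t rho sigma (liftA X d) \<le> res_sum (2 * d) (overlap W V) r s t"
    using nn t by (intro res_form_le[OF rho sigma]) auto
  then show "res_sum 2 (overlap U E) a p t \<le> res_sum (2 * d) (overlap W V) r s t"
    using res_form_liftA[OF X(1) spectral_carrier[OF rho] spectral_carrier[OF sigma]] X(2) by simp
qed

text \<open>Klein's inequality: apply ln x <= x - 1 to x = s_j / r_k and sum with weights w_jk r_k.
  The right-hand side cancels since \<open>w\<close> is doubly stochastic.\<close>

lemma entropy_gain_nonneg: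
  assumes S: "stochastic_image n w r s" and rows: "\<And>j. j < n \<Longrightarrow> (\<Sum>k<n. w j k) = 1"
  shows "(\<Sum>k<n. s k * ln (s k)) \<le> (\<Sum>k<n. r k * ln (r k))"
proof -
  have cols: "\<And>k. k < n \<Longrightarrow> (\<Sum>j<n. w j k) = 1" and s: "\<And>j. j < n \<Longrightarrow> s j = (\<Sum>k<n. w j k * r k)"
    using S by (auto simp: stochastic_image_def)
  have *: "w j k * r k * ln (s j) - w j k * r k * ln (r k) \<le> w j k * s j - w j k * r k" if "j < n" "k < n" for j k
  proof (cases "w j k * r k = 0")
    case True
    have "w j k * s j \<ge> 0"
      using S that by (auto simp: stochastic_image_def intro!: mult_nonneg_nonneg sum_nonneg)
    then show ?thesis unfolding True by simp
  next
    case False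
    then have pos: "r k > 0" "s j > 0" and w: "w j k \<ge> 0"
      using stochastic_image_pos[OF S that] S that by (auto simp: stochastic_image_def)
    have "r k * (ln (s j) - ln (r k)) = r k * ln (s j / r k)"
      using pos by (simp add: ln_div)
    also have "\<dots> \<le> r k * (s j / r k - 1)"
      using pos by (intro mult_left_mono ln_le_minus_one) auto
    also have "\<dots> = s j - r k" using pos by (simp add: field_simps)
    finally show ?thesis
      using mult_left_mono[OF _ w] by (fastforce simp: algebra_simps)
  qed
  have "(\<Sum>j<n. s j * ln (s j)) = (\<Sum>j<n. \<Sum>k<n. w j k * r k * ln (s j))"
    by (simp add: sum_distrib_right[symmetric] s[symmetric])
  moreover have "(\<Sum>k<n. r k * ln (r k)) = (\<Sum>k<n. \<Sum>j<n. w j k * r k * ln (r k))"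
    by (simp add: sum_distrib_right[symmetric] cols mult.assoc)
  ultimately have "(\<Sum>j<n. s j * ln (s j)) - (\<Sum>k<n. r k * ln (r k)) =
      (\<Sum>j<n. \<Sum>k<n. w j k * r k * ln (s j)) - (\<Sum>k<n. \<Sum>j<n. w j k * r k * ln (r k))"
    by simp
  also have "\<dots> = (\<Sum>j<n. \<Sum>k<n. w j k * r k * ln (s j) - w j k * r k * ln (r k))"
    by (subst (2) sum.swap) (simp add: sum_subtractf)
  also have "\<dots> \<le> (\<Sum>j<n. \<Sum>k<n. w j k * s j - w j k * r k)"
    using * by (intro sum_mono) auto
  also have "\<dots> = (\<Sum>j<n. (\<Sum>k<n. w j k) * s j) - (\<Sum>j<n. \<Sum>k<n. w j k * r k)"
    by (simp add: sum_subtractf sum_distrib_right)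
  also have "\<dots> = 0"
    using s rows by simp
  finally show ?thesis by simp
qed

lemma sum_lessThan_2: "(\<Sum>i<2. f i) = f 0 + f (1 :: nat)"
  by (simp add: numeral_2_eq_2)

subsection \<open>Positive semidefinite matrices\<close>

text \<open>Test vectors are functions on indices, so that product vectors can be supplied directly
  as lambda terms in \<open>x div d\<close> and \<open>x mod d\<close>.\<close>

definition psd :: "nat \<Rightarrow> complex mat \<Rightarrow> bool" where
  "psd n M \<longleftrightarrow> M \<in> carrier_mat n n \<and> adj M = M \<and>
     (\<forall>v. 0 \<le> Re (\<Sum>i<n. \<Sum>j<n. cnj (v i) * M $$ (i, j) * v j))"

lemma psd_carrier: "psd n M \<Longrightarrow> M \<in> carrier_mat n n"
  by (simp add: psd_def)

lemma psd_adj: "psd n M \<Longrightarrow> adj M = M"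
  by (simp add: psd_def)

lemma psd_nonneg: "psd n M \<Longrightarrow> 0 \<le> Re (\<Sum>i<n. \<Sum>j<n. cnj (v i) * M $$ (i, j) * v j)"
  by (simp add: psd_def)

lemma adj_eqI:
  assumes "M \<in> carrier_mat n n" "\<And>i j. i < n \<Longrightarrow> j < n \<Longrightarrow> cnj (M $$ (j, i)) = M $$ (i, j)"
  shows "adj M = M"
  using assms by (intro eq_matI) auto

lemma adj_eqD:
  assumes "adj M = M" "M \<in> carrier_mat n n" "i < n" "j < n"
  shows "cnj (M $$ (j, i)) = M $$ (i, j)"
  using assms by (metis adj_index carrier_matD)

lemma psd_spectral_exists:
  assumes "psd n M"
  obtains V r where "spectral n M V r" "\<And>k. k < n \<Longrightarrow> r k \<ge> 0"
proof -
  obtain V r where V: "spectral n M V r"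
    using spectral_exists psd_carrier[OF assms] psd_adj[OF assms] by blast
  moreover have "r k \<ge> 0" if "k < n" for k
    using arg_cong[OF spectral_eigenvalue[OF V that], of Re]
      psd_nonneg[OF assms, of "\<lambda>i. V $$ (i, k)"] by simp
  ultimately show ?thesis
    using that by blast
qed

lemma psd_gramI:
  assumes "M \<in> carrier_mat n n" "finite S"
    and eq: "\<And>i j. i < n \<Longrightarrow> j < n \<Longrightarrow> M $$ (i, j) = (\<Sum>s\<in>S. f s i * cnj (f s j))"
  shows "psd n M"
  unfolding psd_def
proof (intro conjI allI)
  show "adj M = M"
    using assms(1) by (rule adj_eqI) (auto simp: eq mult.commute)
  fix v :: "nat \<Rightarrow> complex"
  have "(\<Sum>i<n. \<Sum>j<n. cnj (v i) * M $$ (i, j) * v j) =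
      (\<Sum>i<n. \<Sum>j<n. \<Sum>s\<in>S. (cnj (v i) * f s i) * cnj (cnj (v j) * f s j))"
    by (intro sum.cong refl) (auto simp: eq sum_distrib_left sum_distrib_right mult_ac)
  also have "\<dots> = (\<Sum>i<n. \<Sum>s\<in>S. \<Sum>j<n. (cnj (v i) * f s i) * cnj (cnj (v j) * f s j))"
    by (intro sum.cong refl sum.swap)
  also have "\<dots> = (\<Sum>s\<in>S. \<Sum>i<n. \<Sum>j<n. (cnj (v i) * f s i) * cnj (cnj (v j) * f s j))"
    by (rule sum.swap)
  also have "\<dots> = (\<Sum>s\<in>S. complex_of_real ((cmod (\<Sum>i<n. cnj (v i) * f s i))\<^sup>2))"
    unfolding complex_norm_square cnj_sum sum_product ..
  finally show "0 \<le> Re (\<Sum>i<n. \<Sum>j<n. cnj (v i) * M $$ (i, j) * v j)"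
    by (simp only: Re_sum Re_complex_of_real) (intro sum_nonneg, simp)
qed (rule assms(1))

lemma psd_proj_vec:
  assumes "v \<in> carrier_vec n"
  shows "psd n (proj_vec v)"
  by (rule psd_gramI[where S = "{()}" and f = "\<lambda>_ i. v $ i"]) (use assms in \<open>auto simp: proj_vec_def\<close>)

text \<open>The quadratic form at \<open>v\<close> is the sum over \<open>b\<close> of the form of
  \<open>rho\<close> at \<open>v\<close> tensored with the b-th basis vector.\<close>

lemma psd_ptrace_B:
  assumes "psd (2 * d) rho"
  shows "psd 2 (ptrace_B rho)"
  unfolding psd_def
proof (intro conjI allI)
  note c = psd_carrier[OF assms]
  show "adj (ptrace_B rho) = ptrace_B rho"
    by (rule adj_eqI[OF ptrace_B_carrier])
      (auto simp: ptrace_B_index[OF c] adj_eqD[OF psd_adj[OF assms] c])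
  fix v :: "nat \<Rightarrow> complex"
  have "(\<Sum>a<2. \<Sum>a'<2. cnj (v a) * ptrace_B rho $$ (a, a') * v a') =
      (\<Sum>a<2. \<Sum>a'<2. \<Sum>b<d. cnj (v a) * rho $$ (a * d + b, a' * d + b) * v a')"
    by (intro sum.cong refl) (auto simp: ptrace_B_index[OF c] sum_distrib_left sum_distrib_right)
  also have "\<dots> = (\<Sum>a<2. \<Sum>b<d. \<Sum>a'<2. cnj (v a) * rho $$ (a * d + b, a' * d + b) * v a')"
    by (intro sum.cong refl sum.swap)
  also have "\<dots> = (\<Sum>b<d. \<Sum>a<2. \<Sum>a'<2. cnj (v a) * rho $$ (a * d + b, a' * d + b) * v a')"
    by (rule sum.swap)
  also have "\<dots> = (\<Sum>b<d. \<Sum>x<2 * d. \<Sum>y<2 * d.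
      cnj (if x mod d = b then v (x div d) else 0) * rho $$ (x, y) * (if y mod d = b then v (y div d) else 0))"
  proof (rule sum.cong[OF refl])
    fix b assume b: "b \<in> {..<d}"
    have "(\<Sum>x<2 * d. \<Sum>y<2 * d.
        cnj (if x mod d = b then v (x div d) else 0) * rho $$ (x, y) * (if y mod d = b then v (y div d) else 0)) =
      (\<Sum>a<2. \<Sum>e<d. if e = b then \<Sum>a'<2. cnj (v a) * rho $$ (a * d + b, a' * d + b) * v a' else 0)"
      unfolding sum_lessThan_2_mult
    proof (rule sum.cong[OF refl], rule sum.cong[OF refl])
      fix a e assume "a \<in> {..<2 :: nat}" "e \<in> {..<d}"
      then show "(\<Sum>a'<2. \<Sum>e'<d. cnj (if (a * d + e) mod d = b then v ((a * d + e) div d) else 0) *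
          rho $$ (a * d + e, a' * d + e') * (if (a' * d + e') mod d = b then v ((a' * d + e') div d) else 0)) =
        (if e = b then \<Sum>a'<2. cnj (v a) * rho $$ (a * d + b, a' * d + b) * v a' else 0)"
        using b by (auto simp: if_distrib[of "\<lambda>y. _ * y"] cong: if_cong)
    qed
    then show "(\<Sum>a<2. \<Sum>a'<2. cnj (v a) * rho $$ (a * d + b, a' * d + b) * v a') = (\<Sum>x<2 * d. \<Sum>y<2 * d.
        cnj (if x mod d = b then v (x div d) else 0) * rho $$ (x, y) * (if y mod d = b then v (y div d) else 0))"
      using b by simp
  qed
  finally show "0 \<le> Re (\<Sum>a<2. \<Sum>a'<2. cnj (v a) * ptrace_B rho $$ (a, a') * v a')"
    using psd_nonneg[OF assms] by (simp add: sum_nonneg)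
qed (rule ptrace_B_carrier)

subsection \<open>Local projective measurements\<close>

text \<open>The partial matrix element <u|rho|u>, an operator on the second system: the conditional
  state after outcome \<open>u\<close>, before division by its probability.\<close>

definition cond_block :: "nat \<Rightarrow> complex mat \<Rightarrow> complex vec \<Rightarrow> complex mat" where
  "cond_block d rho u = mat d d
     (\<lambda>(b, b'). \<Sum>a<2. \<Sum>a'<2. cnj (u $ a) * rho $$ (a * d + b, a' * d + b') * u $ a')"

lemma cond_block_carrier [simp]: "cond_block d rho u \<in> carrier_mat d d"
  by (simp add: cond_block_def)

lemma cond_block_index:
  "b < d \<Longrightarrow> b' < d \<Longrightarrow> cond_block d rho u $$ (b, b') =
     (\<Sum>a<2. \<Sum>a'<2. cnj (u $ a) * rho $$ (a * d + b, a' * d + b') * u $ a')"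
  by (simp add: cond_block_def)

lemma adj_cond_block:
  assumes "rho \<in> carrier_mat (2 * d) (2 * d)" "adj rho = rho"
  shows "adj (cond_block d rho u) = cond_block d rho u"
proof (rule adj_eqI)
  fix b b' assume b: "b < d" "b' < d"
  have "cnj (cond_block d rho u $$ (b', b)) =
      (\<Sum>a<2. \<Sum>a'<2. cnj (u $ a') * rho $$ (a' * d + b, a * d + b') * u $ a)"
    using b by (simp add: cond_block_index adj_eqD[OF assms(2,1)]) (simp add: mult_ac)
  then show "cnj (cond_block d rho u $$ (b', b)) = cond_block d rho u $$ (b, b')"
    using b by (simp add: cond_block_index) (rule sum.swap)
qed simp

text \<open>Test \<open>rho\<close> on the product vector \<open>u\<close> tensor
  \<open>v\<close>.\<close>

lemma psd_cond_block:
  assumes "psd (2 * d) rho"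
  shows "psd d (cond_block d rho u)"
  unfolding psd_def
proof (intro conjI allI)
  show "adj (cond_block d rho u) = cond_block d rho u"
    by (rule adj_cond_block[OF psd_carrier[OF assms] psd_adj[OF assms]])
  fix v :: "nat \<Rightarrow> complex"
  have "(\<Sum>x<2 * d. \<Sum>y<2 * d. cnj (u $ (x div d) * v (x mod d)) * rho $$ (x, y) * (u $ (y div d) * v (y mod d))) =
      (\<Sum>a<2. \<Sum>b<d. \<Sum>a'<2. \<Sum>b'<d. cnj (v b) * (cnj (u $ a) * rho $$ (a * d + b, a' * d + b') * u $ a') * v b')"
    unfolding sum_lessThan_2_mult by (intro sum.cong refl) simp
  also have "\<dots> = (\<Sum>b<d. \<Sum>a<2. \<Sum>b'<d. \<Sum>a'<2. cnj (v b) * (cnj (u $ a) * rho $$ (a * d + b, a' * d + b') * u $ a') * v b')"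
    by (subst sum.swap) (intro sum.cong refl sum.swap)
  also have "\<dots> = (\<Sum>b<d. \<Sum>b'<d. \<Sum>a<2. \<Sum>a'<2. cnj (v b) * (cnj (u $ a) * rho $$ (a * d + b, a' * d + b') * u $ a') * v b')"
    by (intro sum.cong refl sum.swap)
  also have "\<dots> = (\<Sum>b<d. \<Sum>b'<d. cnj (v b) * cond_block d rho u $$ (b, b') * v b')"
    by (intro sum.cong refl) (auto simp: cond_block_index sum_distrib_left sum_distrib_right)
  finally show "0 \<le> Re (\<Sum>b<d. \<Sum>b'<d. cnj (v b) * cond_block d rho u $$ (b, b') * v b')"
    using psd_nonneg[OF assms, of "\<lambda>x. u $ (x div d) * v (x mod d)"] by simp
qed simp

lemma post_meas_carrier:
  "rho \<in> carrier_mat (2 * d) (2 * d) \<Longrightarrow> post_meas rho u \<in> carrier_mat (2 * d) (2 * d)"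
  by (auto simp: post_meas_def Let_def liftA_def)

text \<open>Projecting on both sides leaves |u><u| tensor \<open>cond_block d rho u\<close>.\<close>

lemma post_meas_index:
  assumes rho: "rho \<in> carrier_mat (2 * d) (2 * d)" and u: "u \<in> carrier_vec 2"
    and ab: "a < 2" "b < d" "a' < 2" "b' < d"
  shows "post_meas rho u $$ (a * d + b, a' * d + b') =
    u $ a * cnj (u $ a') * cond_block d rho u $$ (b, b')"
proof -
  let ?L = "liftA (proj_vec u) d"
  have L: "?L $$ (e * d + f, e' * d + f') = (if f = f' then u $ e * cnj (u $ e') else 0)"
    if "e < 2" "f < d" "e' < 2" "f' < d" for e f e' f'
    using u that by (simp add: liftA_index proj_vec_def)
  have 1: "(?L * rho) $$ (a * d + b, y) = (\<Sum>c<2. u $ a * cnj (u $ c) * rho $$ (c * d + b, y))"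
    if y: "y < 2 * d" for y
  proof -
    have "(?L * rho) $$ (a * d + b, y) =
        (\<Sum>c<2. \<Sum>e<d. (if b = e then u $ a * cnj (u $ c) else 0) * rho $$ (c * d + e, y))"
      using rho ab y by (subst mult_mat_index[of _ "2 * d" "2 * d" _ "2 * d"])
        (auto simp: sum_lessThan_2_mult L intro!: sum.cong)
    then show ?thesis
      using ab by (simp add: if_distrib[of "\<lambda>y. y * _"] cong: if_cong)
  qed
  have "post_meas rho u = ?L * rho * ?L"
    using rho by (simp add: post_meas_def Let_def)
  then have "post_meas rho u $$ (a * d + b, a' * d + b') =
      (\<Sum>c'<2. \<Sum>e<d. (\<Sum>c<2. u $ a * cnj (u $ c) * rho $$ (c * d + b, c' * d + e)) *
         (if e = b' then u $ c' * cnj (u $ a') else 0))"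
    using rho ab mult_mat_index[of "?L * rho" "2 * d" "2 * d" ?L "2 * d" "a * d + b" "a' * d + b'"]
      mult_carrier_mat[of ?L "2 * d" "2 * d" rho "2 * d"]
    by (auto simp: sum_lessThan_2_mult 1 L simp del: index_mult_mat(1) intro!: sum.cong)
  also have "\<dots> = (\<Sum>c'<2. (\<Sum>c<2. u $ a * cnj (u $ c) * rho $$ (c * d + b, c' * d + b')) * (u $ c' * cnj (u $ a')))"
    using ab by (simp add: if_distrib[of "\<lambda>y. _ * y"] cong: if_cong)
  also have "\<dots> = u $ a * cnj (u $ a') * (\<Sum>c'<2. \<Sum>c<2. cnj (u $ c) * rho $$ (c * d + b, c' * d + b') * u $ c')"
    by (simp add: sum_distrib_left sum_distrib_right mult_ac)
  also have "(\<Sum>c'<2. \<Sum>c<2. cnj (u $ c) * rho $$ (c * d + b, c' * d + b') * u $ c') = cond_block d rho u $$ (b, b')"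
    using ab by (subst sum.swap) (simp add: cond_block_index)
  finally show ?thesis .
qed

lemma ptrace_A_carrier: "rho \<in> carrier_mat (2 * d) (2 * d) \<Longrightarrow> ptrace_A rho \<in> carrier_mat d d"
  by (simp add: ptrace_A_def Let_def)

lemma ptrace_A_index:
  assumes "rho \<in> carrier_mat (2 * d) (2 * d)" "b < d" "b' < d"
  shows "ptrace_A rho $$ (b, b') = (\<Sum>a<2. rho $$ (a * d + b, a * d + b'))"
  using assms by (simp add: ptrace_A_def Let_def)

lemma cinner_2: "u \<in> carrier_vec 2 \<Longrightarrow> cinner u v = (\<Sum>a<2. v $ a * cnj (u $ a))"
  by (simp add: cinner_def mult.commute)

lemma ptrace_A_post_meas:
  assumes rho: "rho \<in> carrier_mat (2 * d) (2 * d)" and u: "u \<in> carrier_vec 2" "cinner u u = 1"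
  shows "ptrace_A (post_meas rho u) = cond_block d rho u"
proof (rule eq_matI)
  fix b b' assume "b < dim_row (cond_block d rho u)" "b' < dim_col (cond_block d rho u)"
  then have b: "b < d" "b' < d" by (auto simp: cond_block_def)
  have "ptrace_A (post_meas rho u) $$ (b, b') =
      (\<Sum>a<2. u $ a * cnj (u $ a)) * cond_block d rho u $$ (b, b')"
    using b by (simp add: ptrace_A_index[OF post_meas_carrier[OF rho]] post_meas_index[OF rho u(1)]
        sum_distrib_right)
  then show "ptrace_A (post_meas rho u) $$ (b, b') = cond_block d rho u $$ (b, b')"
    using u by (simp add: cinner_2)
qed (use ptrace_A_carrier[OF post_meas_carrier[OF rho], of u] in \<open>auto simp: cond_block_def\<close>)

lemma meas_prob_cond_block:
  assumes rho: "rho \<in> carrier_mat (2 * d) (2 * d)" and u: "u \<in> carrier_vec 2" "cinner u u = 1"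
  shows "meas_prob rho u = Re (mtrace (cond_block d rho u))"
proof -
  have "mtrace (post_meas rho u) = (\<Sum>b<d. (\<Sum>a<2. u $ a * cnj (u $ a)) * cond_block d rho u $$ (b, b))"
    using carrier_matD[OF post_meas_carrier[OF rho, of u]]
    by (simp add: mtrace_def sum_lessThan_2_mult post_meas_index[OF rho u(1)]
        sum_distrib_right sum.swap[of _ "{..<d}"])
  then show ?thesis
    using u by (simp add: meas_prob_def cinner_2 mtrace_def cond_block_def)
qed

definition basis_mat :: "complex vec \<Rightarrow> complex vec \<Rightarrow> complex mat" where
  "basis_mat u0 u1 = mat 2 2 (\<lambda>(a, i). (if i = 0 then u0 else u1) $ a)"

lemma unitary_basis_mat:
  assumes "onb2 u0 u1"
  shows "unitary 2 (basis_mat u0 u1)"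
proof (rule unitaryI_cols)
  note * = assms[unfolded onb2_def]
  have "u0 \<in> carrier_vec 2" "u1 \<in> carrier_vec 2"
    using * by auto
  then have "cinner u1 u0 = cnj (cinner u0 u1)"
    by (simp add: cinner_2 mult.commute)
  then have 10: "cinner u1 u0 = 0"
    using * by simp
  fix k l :: nat assume "k < 2" "l < 2"
  then show "(\<Sum>i<2. cnj (basis_mat u0 u1 $$ (i, k)) * basis_mat u0 u1 $$ (i, l)) = (if k = l then 1 else 0)"
    using * 10 by (auto simp: basis_mat_def cinner_2 less_2_cases_iff mult.commute)
qed (simp add: basis_mat_def)

lemma onb2_cols:
  assumes "unitary 2 E"
  shows "onb2 (col E 0) (col E 1)"
  using unitary_cols[OF assms, of 0 0] unitary_cols[OF assms, of 1 1] unitary_cols[OF assms, of 0 1]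
    unitary_carrier[OF assms]
  by (auto simp: onb2_def cinner_def intro!: carrier_vecI)

lemma post_meas_sum_index:
  assumes rho: "rho \<in> carrier_mat (2 * d) (2 * d)" and u: "onb2 u0 u1"
    and ab: "a < 2" "b < d" "a' < 2" "b' < d"
  shows "(post_meas rho u0 + post_meas rho u1) $$ (a * d + b, a' * d + b') =
    (\<Sum>i<2. basis_mat u0 u1 $$ (a, i) * cnj (basis_mat u0 u1 $$ (a', i)) *
      cond_block d rho (if i = 0 then u0 else u1) $$ (b, b'))"
proof -
  have "u0 \<in> carrier_vec 2" "u1 \<in> carrier_vec 2"
    using u by (auto simp: onb2_def)
  then show ?thesis
    using ab carrier_matD[OF post_meas_carrier[OF rho, of u0]] carrier_matD[OF post_meas_carrier[OF rho, of u1]]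
    by (simp add: post_meas_index[OF rho] basis_mat_def sum_lessThan_2)
qed

lemma post_meas_sum_carrier:
  "rho \<in> carrier_mat (2 * d) (2 * d) \<Longrightarrow> post_meas rho u0 + post_meas rho u1 \<in> carrier_mat (2 * d) (2 * d)"
  using post_meas_carrier by auto

text \<open>In the measured basis the dephased state is block diagonal, so its spectrum is the union
  of those of the two conditional blocks.\<close>

lemma spec_sum_post_meas:
  assumes rho: "rho \<in> carrier_mat (2 * d) (2 * d)" "adj rho = rho" and u: "onb2 u0 u1"
  shows "spec_sum f (post_meas rho u0 + post_meas rho u1) =
    spec_sum f (cond_block d rho u0) + spec_sum f (cond_block d rho u1)"
  using spec_sum_controlled[OF unitary_basis_mat[OF u], of "\<lambda>i. cond_block d rho (if i = 0 then u0 else u1)" d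
      "post_meas rho u0 + post_meas rho u1" f]
    adj_cond_block[OF rho] post_meas_sum_carrier[OF rho(1)] post_meas_sum_index[OF rho(1) u]
  by (simp add: sum_lessThan_2)

section \<open>Entropy balance of a local measurement\<close>

lemma spectral_smult:
  assumes "spectral n M V r"
  shows "spectral n (complex_of_real c \<cdot>\<^sub>m M) V (\<lambda>k. c * r k)"
  using spectral_carrier[OF assms] spectral_unitary[OF assms]
  by (intro spectralI_index) (auto simp: spectral_index[OF assms] sum_distrib_left mult.assoc)

abbreviation xlog :: "real \<Rightarrow> real" where
  "xlog x \<equiv> x * log 2 x"

lemma sum_xlog: "(\<Sum>k\<in>A. xlog (r k)) = (\<Sum>k\<in>A. r k * ln (r k)) / ln 2"
  by (simp add: log_def sum_divide_distrib)

text \<open>For T of trace p, scaling gives p S(T / p) = p log p - tr (T log T).\<close>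

lemma meas_prob_cond_entropy:
  assumes rho: "psd (2 * d) rho" and u: "u \<in> carrier_vec 2" "cinner u u = 1"
  shows "meas_prob rho u * vn_entropy (cond_state rho u) =
    xlog (meas_prob rho u) - spec_sum xlog (cond_block d rho u)"
proof -
  define T where "T = cond_block d rho u"
  define p where "p = meas_prob rho u"
  obtain F t where F: "spectral d T F t" and t: "\<And>k. k < d \<Longrightarrow> t k \<ge> 0"
    using psd_spectral_exists[OF psd_cond_block[OF rho]] unfolding T_def by blast
  have p: "p = (\<Sum>k<d. t k)"
    using mtrace_spectral[OF F] meas_prob_cond_block[OF psd_carrier[OF rho] u] by (simp add: p_def T_def)
  have cs: "cond_state rho u = complex_of_real (1 / p) \<cdot>\<^sub>m T"
    by (simp add: cond_state_def ptrace_A_post_meas[OF psd_carrier[OF rho] u] p_def T_def)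
  show ?thesis
  proof (cases "p = 0")
    \<comment> \<open>Nonnegative eigenvalues with sum 0 all vanish, so both sides are 0 whatever
      the conditional state is.\<close>
    case True
    then have "t k = 0" if "k < d" for k
      using p t that sum_nonneg_eq_0_iff[of "{..<d}" t] by auto
    then show ?thesis
      using True by (simp add: p_def[symmetric] T_def[symmetric] spec_sum_spectral[OF F])
  next
    case False
    then have p0: "p > 0"
      using p t sum_nonneg[of "{..<d}" t] by fastforce
    have "p * spec_sum xlog (cond_state rho u) = (\<Sum>k<d. p * xlog (1 / p * t k))"
      unfolding cs spec_sum_spectral[OF spectral_smult[OF F]] sum_distrib_left ..
    also have "\<dots> = (\<Sum>k<d. xlog (t k) - t k * log 2 p)"
    proof (intro sum.cong refl)
      fix k assume "k \<in> {..<d}"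
      then have "t k \<ge> 0" using t by simp
      then show "p * xlog (1 / p * t k) = xlog (t k) - t k * log 2 p"
        using p0 by (cases "t k = 0") (auto simp: log_divide right_diff_distrib)
    qed
    also have "\<dots> = spec_sum xlog T - xlog p"
      by (simp add: sum_subtractf sum_distrib_right[symmetric] p spec_sum_spectral[OF F])
    finally show ?thesis
      by (simp add: vn_entropy_spec_sum p_def T_def)
  qed
qed

text \<open>The first part says that dephasing cannot lower the entropy. The second is D(rho_A ||
  sigma_A) <= D(rho || sigma) for the dephased state \<open>sigma\<close>, rearranged to fit the
  discord.\<close>

lemma measurement_entropy:
  assumes rho: "psd (2 * d) rho" and u: "onb2 u0 u1"
  shows "spec_sum xlog (post_meas rho u0 + post_meas rho u1) \<le> spec_sum xlog rho" (is ?work)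
    and "spec_sum xlog (ptrace_B rho) - (xlog (meas_prob rho u0) + xlog (meas_prob rho u1)) \<le>
      spec_sum xlog rho - (spec_sum xlog (cond_block d rho u0) + spec_sum xlog (cond_block d rho u1))" (is ?discord)
proof -
  note c = psd_carrier[OF rho]
  define sigma where "sigma = post_meas rho u0 + post_meas rho u1"
  define v where "v i = (if i = 0 then u0 else u1)" for i :: nat
  define T where "T i = cond_block d rho (v i)" for i
  define U where "U = basis_mat u0 u1"
  have U: "unitary 2 U"
    unfolding U_def by (rule unitary_basis_mat[OF u])
  have v: "v i \<in> carrier_vec 2" "cinner (v i) (v i) = 1" for i
    using u by (auto simp: v_def onb2_def)
  have Uv: "U $$ (a, i) = v i $ a" if "a < 2" "i < 2" for a i
    using that by (simp add: U_def basis_mat_def v_def)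
  have sigma: "sigma \<in> carrier_mat (2 * d) (2 * d)"
    unfolding sigma_def by (rule post_meas_sum_carrier[OF c])
  have sigma_index: "sigma $$ (a * d + b, a' * d + b') = (\<Sum>i<2. U $$ (a, i) * cnj (U $$ (a', i)) * T i $$ (b, b'))"
    if "a < 2" "b < d" "a' < 2" "b' < d" for a b a' b'
    unfolding sigma_def U_def T_def v_def by (rule post_meas_sum_index[OF c u that])
  obtain V r where V: "spectral (2 * d) rho V r" and r: "\<And>k. k < 2 * d \<Longrightarrow> r k \<ge> 0"
    using psd_spectral_exists[OF rho] by blast
  obtain E a where E: "spectral 2 (ptrace_B rho) E a" and a: "\<And>k. k < 2 \<Longrightarrow> a k \<ge> 0"
    using psd_spectral_exists[OF psd_ptrace_B[OF rho]] by blast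
  have "\<exists>F t. spectral d (T i) F t" for i
    using spectral_exists[OF psd_carrier[OF psd_cond_block[OF rho]] psd_adj[OF psd_cond_block[OF rho]]]
    by (simp add: T_def)
  then obtain F t where F: "\<And>i. spectral d (T i) (F i) (t i)"
    by metis
  define W where "W = controlled d U F"
  define s where "s x = t (x div d) (x mod d)" for x
  define p where "p i = (\<Sum>l<d. t i l)" for i
  have W: "spectral (2 * d) sigma W s"
    unfolding W_def s_def[abs_def] by (rule spectral_controlled[OF U F sigma sigma_index])
  have pT: "mtrace (T i) = complex_of_real (p i)" for i
    using mtrace_spectral[OF F] by (simp add: p_def)
  have meas: "meas_prob rho (v i) = p i" for i
    using meas_prob_cond_block[OF c v] pT by (simp add: T_def)
  \<comment> \<open>Column (i, l) of \<open>W\<close> is \<open>v i\<close> tensor an eigenvector of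
    \<open>T i\<close>. The expectation of \<open>rho\<close> in it equals that of
    \<open>T i\<close> in the eigenvector, which is an eigenvalue of \<open>sigma\<close>.\<close>
  have S: "stochastic_image (2 * d) (overlap W V) r s"
  proof (rule stochastic_image_overlap[OF V spectral_unitary[OF W] r])
    fix x assume "x < 2 * d"
    define i l where "i = x div d" and "l = x mod d"
    have il: "i < 2" "l < d" and x: "x = i * d + l"
      using \<open>x < 2 * d\<close> by (auto simp: i_def l_def)
    have "(\<Sum>y<2 * d. \<Sum>z<2 * d. cnj (W $$ (y, x)) * rho $$ (y, z) * W $$ (z, x)) =
      (\<Sum>a<2. \<Sum>b<d. \<Sum>a'<2. \<Sum>b'<d. cnj (F i $$ (b, l)) *
        (cnj (v i $ a) * rho $$ (a * d + b, a' * d + b') * v i $ a') * F i $$ (b', l))"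
      unfolding sum_lessThan_2_mult W_def x using il
      by (intro sum.cong refl) (simp add: controlled_index Uv)
    also have "\<dots> = (\<Sum>b<d. \<Sum>a<2. \<Sum>b'<d. \<Sum>a'<2. cnj (F i $$ (b, l)) *
        (cnj (v i $ a) * rho $$ (a * d + b, a' * d + b') * v i $ a') * F i $$ (b', l))"
      by (subst sum.swap) (intro sum.cong refl sum.swap)
    also have "\<dots> = (\<Sum>b<d. \<Sum>b'<d. \<Sum>a<2. \<Sum>a'<2. cnj (F i $$ (b, l)) *
        (cnj (v i $ a) * rho $$ (a * d + b, a' * d + b') * v i $ a') * F i $$ (b', l))"
      by (intro sum.cong refl sum.swap)
    also have "\<dots> = (\<Sum>b<d. \<Sum>b'<d. cnj (F i $$ (b, l)) * T i $$ (b, b') * F i $$ (b', l))"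
      by (intro sum.cong refl) (auto simp: T_def cond_block_index sum_distrib_left sum_distrib_right)
    also have "\<dots> = complex_of_real (s x)"
      using spectral_eigenvalue[OF F il(2), of i] by (simp add: s_def i_def l_def)
    finally show "complex_of_real (s x) =
      (\<Sum>y<2 * d. \<Sum>z<2 * d. cnj (W $$ (y, x)) * rho $$ (y, z) * W $$ (z, x))" ..
  qed
  \<comment> \<open>The diagonal of the reduced state in the measured basis is the outcome
    distribution \<open>p\<close>.\<close>
  have SA: "stochastic_image 2 (overlap U E) a p"
  proof (rule stochastic_image_overlap[OF E U a])
    fix i :: nat assume i: "i < 2"
    have "complex_of_real (p i) = (\<Sum>b<d. \<Sum>a<2. \<Sum>a'<2. cnj (v i $ a) * rho $$ (a * d + b, a' * d + b) * v i $ a')"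
      unfolding pT[symmetric] by (simp add: mtrace_def T_def cond_block_index carrier_matD[OF cond_block_carrier])
    also have "\<dots> = (\<Sum>a<2. \<Sum>a'<2. \<Sum>b<d. cnj (v i $ a) * rho $$ (a * d + b, a' * d + b) * v i $ a')"
      by (subst sum.swap) (intro sum.cong refl sum.swap)
    also have "\<dots> = (\<Sum>a<2. \<Sum>a'<2. cnj (U $$ (a, i)) * ptrace_B rho $$ (a, a') * U $$ (a', i))"
      using i by (intro sum.cong refl) (auto simp: Uv ptrace_B_index[OF c] sum_distrib_left sum_distrib_right)
    finally show "complex_of_real (p i) = (\<Sum>a<2. \<Sum>a'<2. cnj (U $$ (a, i)) * ptrace_B rho $$ (a, a') * U $$ (a', i))" .
  qed
  \<comment> \<open>The reduced dephased state is diagonal in the measured basis, with the traces of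
    the blocks \<open>T i\<close> as eigenvalues.\<close>
  have sigmaA: "spectral 2 (ptrace_B sigma) U p"
  proof (rule spectralI_index[OF U ptrace_B_carrier])
    fix a a' :: nat assume a: "a < 2" "a' < 2"
    have "ptrace_B sigma $$ (a, a') = (\<Sum>b<d. \<Sum>i<2. T i $$ (b, b) * (U $$ (a, i) * cnj (U $$ (a', i))))"
      using a by (simp add: ptrace_B_index[OF sigma] sigma_index mult.commute)
    also have "\<dots> = (\<Sum>i<2. mtrace (T i) * (U $$ (a, i) * cnj (U $$ (a', i))))"
      by (subst sum.swap) (simp add: mtrace_def T_def sum_distrib_right carrier_matD[OF cond_block_carrier])
    finally show "ptrace_B sigma $$ (a, a') = (\<Sum>i<2. complex_of_real (p i) * (U $$ (a, i) * cnj (U $$ (a', i))))"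
      by (simp add: pT)
  qed
  have sum_s: "spec_sum f (cond_block d rho u0) + spec_sum f (cond_block d rho u1) = (\<Sum>k<2 * d. f (s k))" for f
    using spec_sum_post_meas[OF c psd_adj[OF rho] u, of f] spec_sum_spectral[OF W, of f]
    by (simp add: sigma_def)
  have "(\<Sum>k<2 * d. s k * ln (s k)) \<le> (\<Sum>k<2 * d. r k * ln (r k))"
    using sum_overlap_right[OF spectral_unitary[OF W] spectral_unitary[OF V]]
    by (intro entropy_gain_nonneg[OF S]) auto
  then show ?work
    unfolding sigma_def[symmetric] spec_sum_spectral[OF W] spec_sum_spectral[OF V] sum_xlog
    by (simp add: divide_right_mono)
  have p2: "xlog (meas_prob rho u0) + xlog (meas_prob rho u1) = (\<Sum>i<2. xlog (p i))"
    using meas[of 0] meas[of 1] by (simp add: v_def sum_lessThan_2)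
  have "(\<Sum>k<2. a k * ln (a k)) - (\<Sum>k<2. p k * ln (p k)) \<le>
    (\<Sum>k<2 * d. r k * ln (r k)) - (\<Sum>k<2 * d. s k * ln (s k))"
    by (rule relative_entropy_ptrace_B[OF V W E sigmaA S SA])
  then show ?discord
    unfolding p2 sum_s spec_sum_spectral[OF E] spec_sum_spectral[OF V] sum_xlog
    by (simp add: diff_divide_distrib[symmetric] divide_right_mono)
qed

lemma onb2_exists: "\<exists>u0 u1. onb2 u0 u1"
  using onb2_cols[of "1\<^sub>m 2"] by (auto simp: unitary_def)

text \<open>The entropy of the second system cancels between mutual information and classical
  correlation. The bound that remains holds for every single measurement, hence for the
  infimum.\<close>

theorem discord_nonneg:
  assumes rho: "psd (2 * d) rho"
  shows "discord rho \<ge> 0"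
proof -
  have "vn_entropy rho - vn_entropy (ptrace_B rho) \<le> Inf {cond_entropy_meas rho u0 u1 | u0 u1. onb2 u0 u1}"
  proof (rule cInf_greatest)
    fix x assume "x \<in> {cond_entropy_meas rho u0 u1 | u0 u1. onb2 u0 u1}"
    then obtain u0 u1 where u: "onb2 u0 u1" and x: "x = cond_entropy_meas rho u0 u1" by blast
    have u01: "u0 \<in> carrier_vec 2" "cinner u0 u0 = 1" "u1 \<in> carrier_vec 2" "cinner u1 u1 = 1"
      using u by (auto simp: onb2_def)
    show "vn_entropy rho - vn_entropy (ptrace_B rho) \<le> x"
      unfolding x cond_entropy_meas_def meas_prob_cond_entropy[OF rho u01(1,2)]
        meas_prob_cond_entropy[OF rho u01(3,4)]
      using measurement_entropy(2)[OF rho u] by (simp add: vn_entropy_spec_sum)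
  qed (use onb2_exists in auto)
  then show ?thesis
    by (simp add: discord_def mutual_info_def classical_corr_def)
qed

lemma entropy_le_post_meas:
  assumes "psd (2 * d) rho" "onb2 u0 u1"
  shows "vn_entropy rho \<le> vn_entropy (post_meas rho u0 + post_meas rho u1)"
  using measurement_entropy(1)[OF assms] by (simp add: vn_entropy_spec_sum)

theorem work_deficit_nonneg:
  assumes rho: "psd (2 * d) rho"
  shows "work_deficit rho \<ge> 0"
proof -
  have "vn_entropy rho \<le> Inf {vn_entropy (post_meas rho u0 + post_meas rho u1) | u0 u1. onb2 u0 u1}"
    using onb2_exists entropy_le_post_meas[OF rho] by (intro cInf_greatest) auto
  then show ?thesis
    by (simp add: work_deficit_def)
qed

subsection \<open>Pure states of a qubit and a second system\<close>

lemma proj_vec_carrier: "v \<in> carrier_vec n \<Longrightarrow> proj_vec v \<in> carrier_mat n n"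
  by (simp add: proj_vec_def)

lemma smult_one_mat: "1 \<cdot>\<^sub>m A = (A :: complex mat)"
  by (rule eq_matI) auto

lemma spec_sum_proj_vec: "f 0 = 0 \<Longrightarrow> spec_sum f (proj_vec v) = f (\<Sum>i<dim_vec v. (cmod (v $ i))\<^sup>2)"
  using spec_sum_scaled_proj_vec[of f 1 v] by (simp add: smult_one_mat)

lemma mtrace_proj_vec: "mtrace (proj_vec v) = complex_of_real (\<Sum>i<dim_vec v. (cmod (v $ i))\<^sup>2)"
  by (simp add: mtrace_def proj_vec_def complex_norm_square del: of_real_power)

text \<open>Contracting the qubit of a pure state with \<open>u\<close> leaves a vector of the
  second system, so conditional blocks of pure states have rank at most one.\<close>

lemma cond_block_proj_vec:
  assumes "phi \<in> carrier_vec (2 * d)"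
  shows "cond_block d (proj_vec phi) u = proj_vec (vec d (\<lambda>b. \<Sum>a<2. cnj (u $ a) * phi $ (a * d + b)))"
proof (rule eq_matI)
  fix b b' assume "b < dim_row (proj_vec (vec d (\<lambda>b. \<Sum>a<2. cnj (u $ a) * phi $ (a * d + b))))"
    "b' < dim_col (proj_vec (vec d (\<lambda>b. \<Sum>a<2. cnj (u $ a) * phi $ (a * d + b))))"
  then have "b < d" "b' < d" by (auto simp: proj_vec_def)
  then show "cond_block d (proj_vec phi) u $$ (b, b') =
      proj_vec (vec d (\<lambda>b. \<Sum>a<2. cnj (u $ a) * phi $ (a * d + b))) $$ (b, b')"
    using assms by (simp add: cond_block_index proj_vec_def sum_product) (simp add: mult_ac)
qed (auto simp: cond_block_def proj_vec_def)

lemma spec_sum_cond_block_pure: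
  assumes phi: "phi \<in> carrier_vec (2 * d)" and u: "u \<in> carrier_vec 2" "cinner u u = 1" and f0: "f 0 = 0"
  shows "spec_sum f (complex_of_real c \<cdot>\<^sub>m cond_block d (proj_vec phi) u) = f (c * meas_prob (proj_vec phi) u)"
  unfolding meas_prob_cond_block[OF proj_vec_carrier[OF phi] u]
  by (simp only: cond_block_proj_vec[OF phi] spec_sum_scaled_proj_vec[where f = f, OF f0] mtrace_proj_vec Re_complex_of_real)

lemma vn_entropy_pure:
  assumes "(\<Sum>i<dim_vec phi. (cmod (phi $ i))\<^sup>2) = 1"
  shows "vn_entropy (proj_vec phi) = 0"
  using assms by (simp add: vn_entropy_spec_sum spec_sum_proj_vec)

text \<open>For a joint pure state every conditional state is pure (or zero, for an outcome of
  probability 0), so all conditional entropies vanish and so does the joint entropy.\<close>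

lemma discord_pure:
  assumes phi: "phi \<in> carrier_vec (2 * d)" and norm: "(\<Sum>i<2 * d. (cmod (phi $ i))\<^sup>2) = 1"
  shows "discord (proj_vec phi) = vn_entropy (ptrace_B (proj_vec phi))"
proof -
  have "cond_entropy_meas (proj_vec phi) u0 u1 = 0" if "onb2 u0 u1" for u0 u1
  proof -
    have *: "meas_prob (proj_vec phi) u * vn_entropy (cond_state (proj_vec phi) u) = 0"
      if u: "u \<in> carrier_vec 2" "cinner u u = 1" for u
      unfolding cond_state_def ptrace_A_post_meas[OF proj_vec_carrier[OF phi] u] vn_entropy_spec_sum
      \<comment> \<open>With p the outcome probability, the argument of \<open>xlog\<close> becomes
        \<open>1 / p * p\<close>, which is 1 or, for p = 0, 0; \<open>xlog\<close> vanishes at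
        both.\<close>
      by (subst spec_sum_cond_block_pure[OF phi u]) auto
    show ?thesis
      using that *[of u0] *[of u1] unfolding cond_entropy_meas_def onb2_def by auto
  qed
  then have "{cond_entropy_meas (proj_vec phi) u0 u1 | u0 u1. onb2 u0 u1} = {0}"
    using onb2_exists by force
  then show ?thesis
    using vn_entropy_pure[of phi] phi norm by (simp add: discord_def mutual_info_def classical_corr_def)
qed

text \<open>An upper bound on the infimum takes just one measurement: the eigenbasis of the reduced
  qubit. Its outcome probabilities are the eigenvalues \<open>a\<close>, and each conditional block
  has its probability as its only possibly nonzero eigenvalue.\<close>

lemma work_deficit_pure:
  assumes phi: "phi \<in> carrier_vec (2 * d)" and norm: "(\<Sum>i<2 * d. (cmod (phi $ i))\<^sup>2) = 1"
  shows "work_deficit (proj_vec phi) \<le> vn_entropy (ptrace_B (proj_vec phi))"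
proof -
  let ?rho = "proj_vec phi"
  note rho = psd_proj_vec[OF phi] and c = proj_vec_carrier[OF phi]
  obtain E a where E: "spectral 2 (ptrace_B ?rho) E a"
    using spectral_exists[OF ptrace_B_carrier] psd_adj[OF psd_ptrace_B[OF rho]] by blast
  note cE = unitary_carrier[OF spectral_unitary[OF E]]
  have onb: "onb2 (col E 0) (col E 1)"
    by (rule onb2_cols[OF spectral_unitary[OF E]])
  have p: "meas_prob ?rho (col E i) = a i" if i: "i < 2" "col E i \<in> carrier_vec 2" "cinner (col E i) (col E i) = 1" for i
  proof -
    have "mtrace (cond_block d ?rho (col E i)) =
        (\<Sum>b<d. \<Sum>e<2. \<Sum>e'<2. cnj (E $$ (e, i)) * ?rho $$ (e * d + b, e' * d + b) * E $$ (e', i))"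
      using cE i by (simp add: mtrace_def cond_block_index carrier_matD[OF cond_block_carrier])
    also have "\<dots> = (\<Sum>e<2. \<Sum>e'<2. \<Sum>b<d. cnj (E $$ (e, i)) * ?rho $$ (e * d + b, e' * d + b) * E $$ (e', i))"
      by (subst sum.swap) (intro sum.cong refl sum.swap)
    also have "\<dots> = (\<Sum>e<2. \<Sum>e'<2. cnj (E $$ (e, i)) * ptrace_B ?rho $$ (e, e') * E $$ (e', i))"
      by (intro sum.cong refl) (auto simp: ptrace_B_index[OF c] sum_distrib_left sum_distrib_right)
    also have "\<dots> = complex_of_real (a i)"
      using spectral_eigenvalue[OF E i(1)] by simp
    finally show ?thesis
      using meas_prob_cond_block[OF c i(2,3)] by simp
  qed
  have q: "spec_sum xlog (cond_block d ?rho u) = xlog (meas_prob ?rho u)"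
    if "u \<in> carrier_vec 2" "cinner u u = 1" for u
    using spec_sum_cond_block_pure[OF phi that, of xlog 1] by (simp add: smult_one_mat)
  have "vn_entropy (post_meas ?rho (col E 0) + post_meas ?rho (col E 1)) =
      - (xlog (meas_prob ?rho (col E 0)) + xlog (meas_prob ?rho (col E 1)))"
    unfolding vn_entropy_spec_sum spec_sum_post_meas[OF c psd_adj[OF rho] onb]
    using onb q[of "col E 0"] q[of "col E 1"] unfolding onb2_def by simp
  also have "\<dots> = vn_entropy (ptrace_B ?rho)"
    using p[of 0] p[of 1] onb by (simp add: vn_entropy_spec_sum spec_sum_spectral[OF E] onb2_def sum_lessThan_2)
  finally have "vn_entropy (ptrace_B ?rho) \<in>
      {vn_entropy (post_meas ?rho u0 + post_meas ?rho u1) | u0 u1. onb2 u0 u1}"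
    using onb unfolding mem_Collect_eq by metis
  \<comment> \<open>The infimum of a real set lies below its members only if the set is bounded
    below; the entropy of \<open>?rho\<close> is such a bound.\<close>
  then have "Inf {vn_entropy (post_meas ?rho u0 + post_meas ?rho u1) | u0 u1. onb2 u0 u1} \<le>
      vn_entropy (ptrace_B ?rho)"
    using entropy_le_post_meas[OF rho] by (intro cInf_lower bdd_belowI[of _ "vn_entropy ?rho"]) auto
  then show ?thesis
    using vn_entropy_pure[of phi] phi norm by (simp add: work_deficit_def)
qed

section \<open>Determinant and negativity of a pure state\<close>

lemma det_spectral:
  assumes "spectral n M V r"
  shows "det M = complex_of_real (\<Prod>k<n. r k)"
proof -
  note u = spectral_unitary[OF assms]
  note c = unitary_carrier[OF u]
  have "det M = (det V * det (adj V)) * det (diag_real n r)"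
    using assms c by (simp add: spectral_def det_mult[of _ n] mult_ac)
  also have "det V * det (adj V) = 1"
    using c unitary_right[OF u] det_mult[of V n "adj V"] by simp
  also have "det (diag_real n r) = prod_list (diag_mat (diag_real n r))"
    by (rule det_upper_triangular[of _ n]) auto
  also have "diag_mat (diag_real n r) = map (\<lambda>k. complex_of_real (r k)) [0..<n]"
    by (auto simp: diag_mat_def)
  also have "prod_list (map (\<lambda>k. complex_of_real (r k)) [0..<n]) = complex_of_real (\<Prod>k<n. r k)"
    by (simp add: prod.distinct_set_conv_list[symmetric] atLeast0LessThan)
  finally show ?thesis by simp
qed

lemma ptrace_B_proj_vec_index:
  assumes phi: "phi \<in> carrier_vec (2 * d)" and a: "a < 2" "a' < 2"
  shows "ptrace_B (proj_vec phi) $$ (a, a') = (\<Sum>b<d. phi $ (a * d + b) * cnj (phi $ (a' * d + b)))"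
  using a phi by (subst ptrace_B_index[OF proj_vec_carrier[OF phi] a]) (simp add: proj_vec_def)

text \<open>The square of the partial transpose of a pure state is \<open>G \<otimes> B\<close> with \<open>G\<close> the transpose of the
  reduced state of the qubit and \<open>B\<close> the reduced state of the second system.\<close>

lemma trace_norm_ptrans_A_pure:
  assumes phi: "phi \<in> carrier_vec (2 * d)"
    and E: "spectral 2 ((ptrace_B (proj_vec phi))\<^sup>T) E g" and g: "\<And>i. i < 2 \<Longrightarrow> g i \<ge> 0"
  shows "trace_norm (ptrans_A (proj_vec phi)) = (sqrt (g 0) + sqrt (g 1))\<^sup>2"
proof -
  define M where "M = ptrans_A (proj_vec phi)"
  define G where "G = (ptrace_B (proj_vec phi))\<^sup>T"
  \<comment> \<open>The amplitudes of \<open>phi\<close> reshaped as a matrix: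
    \<open>K * adj K\<close> is the reduced state of the second system, \<open>adj K * K\<close> the
    transposed reduced state of the qubit. Hence both have the same nonzero eigenvalues.\<close>
  define K where "K = mat d 2 (\<lambda>(b, c). phi $ (c * d + b))"
  define B where "B = K * adj K"
  have K: "K \<in> carrier_mat d 2" by (simp add: K_def)
  then have B: "B \<in> carrier_mat d d" and adjB: "adj B = B"
    by (auto simp: B_def adj_mult[of _ d 2 _ d])
  have M: "M \<in> carrier_mat (2 * d) (2 * d)"
    using phi by (simp add: M_def ptrans_A_def Let_def proj_vec_def)
  have M_index: "M $$ (a * d + b, a' * d + b') = phi $ (a' * d + b) * cnj (phi $ (a * d + b'))"
    if "a < 2" "b < d" "a' < 2" "b' < d" for a b a' b' :: nat
    using phi that by (simp add: M_def ptrans_A_def Let_def proj_vec_def)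
  have G_index: "G $$ (a, a') = (\<Sum>e<d. cnj (phi $ (a * d + e)) * phi $ (a' * d + e))" if "a < 2" "a' < 2" for a a' :: nat
    using that carrier_matD[OF ptrace_B_carrier[of "proj_vec phi"]]
    by (simp add: G_def ptrace_B_proj_vec_index[OF phi] mult.commute)
  have B_index: "B $$ (b, b') = (\<Sum>c<2. phi $ (c * d + b) * cnj (phi $ (c * d + b')))" if "b < d" "b' < d" for b b'
    unfolding B_def using K that by (subst mult_mat_index[of _ d 2 _ d]) (auto simp: K_def)
  obtain F t where F: "spectral d B F t"
    using spectral_exists[OF B adjB] by blast
  have "adj K * K = G"
  proof (rule eq_matI)
    fix a a' assume "a < dim_row G" "a' < dim_col G"
    then have a: "a < 2" "a' < 2"
      using carrier_matD[OF ptrace_B_carrier[of "proj_vec phi"]] by (auto simp: G_def)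
    then show "(adj K * K) $$ (a, a') = G $$ (a, a')"
      using K by (subst mult_mat_index[of _ 2 d _ 2]) (auto simp: K_def G_index)
  qed (use K carrier_matD[OF ptrace_B_carrier[of "proj_vec phi"]] in \<open>auto simp: G_def\<close>)
  then have "spec_sum sqrt B = spec_sum sqrt G"
    unfolding B_def using K by (subst spec_sum_mult_commute[of _ d 2]) auto
  then have sB: "spec_sum sqrt B = sqrt (g 0) + sqrt (g 1)"
    using spec_sum_spectral[OF E] by (simp add: G_def sum_lessThan_2)
  have scaled: "spec_sum sqrt (complex_of_real x \<cdot>\<^sub>m B) = sqrt x * spec_sum sqrt B" for x
    by (simp add: spec_sum_spectral[OF spectral_smult[OF F]] spec_sum_spectral[OF F] real_sqrt_mult sum_distrib_left)
  \<comment> \<open>Diagonalising the factor \<open>G\<close> splits the tensor product into the two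
    blocks \<open>g i\<close> times \<open>B\<close>.\<close>
  have "spec_sum sqrt (adj M * M) = (\<Sum>i<2. spec_sum sqrt (complex_of_real (g i) \<cdot>\<^sub>m B))"
  proof (rule spec_sum_controlled[OF spectral_unitary[OF E]])
    show "adj (complex_of_real (g i) \<cdot>\<^sub>m B) = complex_of_real (g i) \<cdot>\<^sub>m B" for i
      using B adj_eqD[OF adjB B] by (intro adj_eqI[of _ d]) auto
    fix a b a' b' :: nat assume ab: "a < 2" "b < d" "a' < 2" "b' < d"
    have "(adj M * M) $$ (a * d + b, a' * d + b') =
        (\<Sum>c<2. \<Sum>e<d. cnj (M $$ (c * d + e, a * d + b)) * M $$ (c * d + e, a' * d + b'))"
      using M ab by (subst mult_mat_index[of _ "2 * d" "2 * d" _ "2 * d"]) (auto simp: sum_lessThan_2_mult)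
    also have "\<dots> = (\<Sum>c<2. \<Sum>e<d. (phi $ (c * d + b) * cnj (phi $ (c * d + b'))) *
        (cnj (phi $ (a * d + e)) * phi $ (a' * d + e)))"
      using ab by (intro sum.cong refl) (simp add: M_index)
    also have "\<dots> = B $$ (b, b') * G $$ (a, a')"
      using ab by (simp add: B_index G_index sum_product)
    also have "\<dots> = (\<Sum>i<2. E $$ (a, i) * cnj (E $$ (a', i)) * (complex_of_real (g i) \<cdot>\<^sub>m B) $$ (b, b'))"
      using ab B spectral_index[OF E[folded G_def] ab(1,3)] by (simp add: sum_distrib_left mult_ac)
    finally show "(adj M * M) $$ (a * d + b, a' * d + b') =
        (\<Sum>i<2. E $$ (a, i) * cnj (E $$ (a', i)) * (complex_of_real (g i) \<cdot>\<^sub>m B) $$ (b, b'))" .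
  qed (use B M in auto)
  then show ?thesis
    unfolding trace_norm_spec_sum M_def[symmetric] scaled sB
    by (simp add: sum_lessThan_2 power2_eq_square algebra_simps)
qed

lemma psd_transpose:
  assumes "psd n M"
  shows "psd n (M\<^sup>T)"
  unfolding psd_def
proof (intro conjI allI)
  note c = psd_carrier[OF assms]
  show "M\<^sup>T \<in> carrier_mat n n"
    using c by simp
  show "adj (M\<^sup>T) = M\<^sup>T"
    using c adj_eqD[OF psd_adj[OF assms] c] by (intro adj_eqI[of _ n]) auto
  fix v :: "nat \<Rightarrow> complex"
  have "(\<Sum>i<n. \<Sum>j<n. cnj (v i) * M\<^sup>T $$ (i, j) * v j) =
      (\<Sum>i<n. \<Sum>j<n. cnj (cnj (v i)) * M $$ (i, j) * cnj (v j))"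
    using c by (subst sum.swap) (auto simp: mult_ac intro!: sum.cong)
  then show "0 \<le> Re (\<Sum>i<n. \<Sum>j<n. cnj (v i) * M\<^sup>T $$ (i, j) * v j)"
    using psd_nonneg[OF assms, of "\<lambda>i. cnj (v i)"] by simp
qed

text \<open>The eigenvalues sum to 1, so (sqrt g0 + sqrt g1)^2 = 1 + 2 sqrt (g0 g1), and the
  negativity is the square root of the determinant.\<close>

lemma negativity_pure:
  assumes phi: "phi \<in> carrier_vec (2 * d)" and norm: "(\<Sum>i<2 * d. (cmod (phi $ i))\<^sup>2) = 1"
  shows "(negativity (proj_vec phi))\<^sup>2 = Re (det (ptrace_B (proj_vec phi)))"
proof -
  let ?G = "(ptrace_B (proj_vec phi))\<^sup>T"
  note c = ptrace_B_carrier[of "proj_vec phi"]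
  obtain E g where E: "spectral 2 ?G E g" and g: "\<And>i. i < 2 \<Longrightarrow> g i \<ge> 0"
    using psd_spectral_exists[OF psd_transpose[OF psd_ptrace_B[OF psd_proj_vec[OF phi]]]] by blast
  have "complex_of_real (g 0 + g 1) = mtrace ?G"
    using mtrace_spectral[OF E] by (simp add: sum_lessThan_2)
  also have "\<dots> = mtrace (ptrace_B (proj_vec phi))"
    using c by (simp add: mtrace_def carrier_matD[OF c])
  also have "\<dots> = complex_of_real 1"
    using phi norm by (simp only: mtrace_ptrace_B[OF proj_vec_carrier[OF phi]] mtrace_proj_vec carrier_vecD)
  finally have sum: "g 0 + g 1 = 1"
    by (simp only: of_real_eq_iff)
  have det: "Re (det (ptrace_B (proj_vec phi))) = g 0 * g 1"
    using det_spectral[OF E] det_transpose[OF c] by (simp add: numeral_2_eq_2)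
  have nn: "g 0 \<ge> 0" "g 1 \<ge> 0" using g by auto
  then have "trace_norm (ptrans_A (proj_vec phi)) = 1 + 2 * sqrt (g 0 * g 1)"
    using trace_norm_ptrans_A_pure[OF phi E g] sum by (simp add: power2_sum real_sqrt_mult)
  then have "negativity (proj_vec phi) = sqrt (g 0 * g 1)"
    by (simp add: negativity_def)
  then show ?thesis
    using nn det by simp
qed

subsection \<open>Reduced states of an \<open>n\<close>-qubit state\<close>

lemma sum_odd_digits: "(\<Sum>t<m. if odd (s div 2 ^ t) then 2 ^ t else 0) = s mod (2 ^ m :: nat)"
proof (induction m)
  case (Suc m)
  have "s mod 2 ^ Suc m = 2 ^ m * (s div 2 ^ m mod 2) + s mod 2 ^ m"
    using mod_mult2_eq[of s "2 ^ m" 2] by (simp add: mult.commute)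
  then show ?case
    using Suc by (auto simp: odd_iff_mod_2_eq_one even_iff_mod_2_eq_zero)
qed simp

lemma spread_single: "r < 2 \<Longrightarrow> spread {j} r = r * 2 ^ j"
  by (auto simp: spread_def less_2_cases_iff)

lemma sorted_list_of_set_lessThan_minus:
  assumes "j < n"
  shows "sorted_list_of_set ({..<n} - {j}) = [0..<j] @ [Suc j..<n]"
proof -
  have "sorted_wrt (<) ([0..<j] @ [Suc j..<n])" "set ([0..<j] @ [Suc j..<n]) = {..<n} - {j}"
    using assms by (auto simp: sorted_wrt_append)
  then show ?thesis
    by (metis sorted_list_of_set.idem_if_sorted_distinct strict_sorted_iff)
qed

lemma card_lessThan_minus: "j < n \<Longrightarrow> card ({..<n} - {j}) = n - 1"
  by simp

text \<open>A zero bit is inserted at position \<open>j\<close>: the lower digits stay, the higher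
  ones move up by one place.\<close>

lemma spread_lessThan_minus:
  assumes j: "j < n" and s: "s < 2 ^ (n - 1)"
  shows "spread ({..<n} - {j}) s = s mod 2 ^ j + 2 * 2 ^ j * (s div 2 ^ j)"
proof -
  define bit where "bit t = (if odd (s div 2 ^ t) then 2 ^ t else 0 :: nat)" for t
  have digits: "(\<Sum>t<m. bit t) = s mod 2 ^ m" for m
    unfolding bit_def by (rule sum_odd_digits)
  have split: "(\<Sum>t<n - 1. f t) = (\<Sum>t<j. f t) + (\<Sum>t=j..<n - 1. f t)" for f :: "nat \<Rightarrow> nat"
    using j by (subst sum.union_disjoint[symmetric]) (auto intro!: sum.cong)
  have "spread ({..<n} - {j}) s =
      (\<Sum>t<n - 1. if odd (s div 2 ^ t) then 2 ^ (([0..<j] @ [Suc j..<n]) ! t) else 0)"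
    by (simp only: spread_def card_lessThan_minus[OF j] sorted_list_of_set_lessThan_minus[OF j])
  \<comment> \<open>Entry \<open>t\<close> of the list is \<open>t\<close> below \<open>j\<close>
    and \<open>t + 1\<close> from \<open>j\<close> on, which doubles the place value.\<close>
  also have "\<dots> = (\<Sum>t<j. bit t) + (\<Sum>t=j..<n - 1. 2 * bit t)"
    unfolding split by (intro arg_cong2[of _ _ _ _ "(+)"] sum.cong refl) (auto simp: bit_def nth_append)
  finally have 1: "spread ({..<n} - {j}) s = (\<Sum>t<j. bit t) + 2 * (\<Sum>t=j..<n - 1. bit t)"
    by (simp add: sum_distrib_left)
  have "s = (\<Sum>t<j. bit t) + (\<Sum>t=j..<n - 1. bit t)"
    using split[of bit] s by (simp add: digits)
  then have "(\<Sum>t=j..<n - 1. bit t) = 2 ^ j * (s div 2 ^ j)"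
    unfolding digits by (metis add_left_cancel add.commute mult_div_mod_eq)
  then show ?thesis
    unfolding 1 digits by simp
qed

text \<open>For P = 2^j, the pair of a bit and a remaining index corresponds bijectively to a full
  index. The inverse reads off bit \<open>j\<close> and closes the gap.\<close>

lemma sum_insert_bit:
  fixes f :: "nat \<Rightarrow> 'a :: comm_monoid_add"
  assumes "P > 0"
  shows "(\<Sum>a<2. \<Sum>s<P * Q. f (a * P + (s mod P + 2 * P * (s div P)))) = (\<Sum>i<2 * (P * Q). f i)"
proof -
  have "(\<Sum>(a, s)\<in>{..<2} \<times> {..<P * Q}. f (a * P + (s mod P + 2 * P * (s div P)))) = (\<Sum>i<2 * (P * Q). f i)"
  proof (rule sum.reindex_bij_witness[where j = "\<lambda>(a, s). a * P + (s mod P + 2 * P * (s div P))"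
        and i = "\<lambda>i. (i div P mod 2, i mod P + P * (i div (2 * P)))"])
    fix x :: "nat \<times> nat" assume "x \<in> {..<2} \<times> {..<P * Q}"
    then obtain a s where x: "x = (a, s)" "a < 2" "s < P * Q" by auto
    define i where "i = a * P + (s mod P + 2 * P * (s div P))"
    have i: "i = P * (a + 2 * (s div P)) + s mod P"
      by (simp add: i_def algebra_simps)
    have 1: "i div P = a + 2 * (s div P)"
      unfolding i using assms by simp
    have 2: "i mod P = s mod P"
      unfolding i by simp
    have 3: "i div (2 * P) = s div P"
      using x(2) by (simp add: div_mult2_eq mult.commute[of 2] 1)
    show "(case case x of (a, s) \<Rightarrow> a * P + (s mod P + 2 * P * (s div P)) of
        i \<Rightarrow> (i div P mod 2, i mod P + P * (i div (2 * P)))) = x"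
      using x by (simp add: i_def[symmetric] 1 2 3)
    have "s div P < Q"
      using x(3) by (simp add: less_mult_imp_div_less mult.commute)
    then have "i div P < 2 * Q"
      unfolding 1 using x(2) by linarith
    then have "i < 2 * (P * Q)"
      using assms div_less_iff_less_mult[of P i "2 * Q"] by (simp add: mult_ac)
    then show "(case x of (a, s) \<Rightarrow> a * P + (s mod P + 2 * P * (s div P))) \<in> {..<2 * (P * Q)}"
      by (simp add: x(1) i_def)
  next
    fix i assume i: "i \<in> {..<2 * (P * Q)}"
    have "i div (2 * P) < Q"
      using i by (simp add: less_mult_imp_div_less mult_ac)
    then have "P * (i div (2 * P) + 1) \<le> P * Q"
      by (intro mult_le_mono2) simp
    then have "i mod P + P * (i div (2 * P)) < P * Q"
      using mod_less_divisor[OF assms, of i] unfolding distrib_left by linarith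
    then show "(i div P mod 2, i mod P + P * (i div (2 * P))) \<in> {..<2} \<times> {..<P * Q}"
      by simp
    have 1: "(i mod P + P * (i div (2 * P))) mod P = i mod P" "(i mod P + P * (i div (2 * P))) div P = i div (2 * P)"
      using assms by auto
    have 2: "i div P mod 2 * P + 2 * P * (i div (2 * P)) = P * (i div P)"
      using mult_div_mod_eq[of 2 "i div P"] by (metis (no_types, opaque_lifting) add.commute distrib_left div_mult2_eq mult.assoc mult.commute)
    show "(case (i div P mod 2, i mod P + P * (i div (2 * P))) of
        (a, s) \<Rightarrow> a * P + (s mod P + 2 * P * (s div P))) = i"
      unfolding prod.case 1 using 2 mult_div_mod_eq[of P i] by linarith
  qed auto
  then show ?thesis
    by (simp add: sum.cartesian_product)
qed

lemma split_vec_carrier: "split_vec n j psi \<in> carrier_vec (2 * 2 ^ (n - 1))"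
  by (simp add: split_vec_def Let_def)

lemma split_vec_index:
  assumes "a < 2" "s < 2 ^ (n - 1)"
  shows "split_vec n j psi $ (a * 2 ^ (n - 1) + s) = psi $ (a * 2 ^ j + spread ({..<n} - {j}) s)"
  using assms by (simp add: split_vec_def Let_def)

lemma norm_split_vec:
  assumes "pure_state n psi" and j: "j < n"
  shows "(\<Sum>i<2 * 2 ^ (n - 1). (cmod (split_vec n j psi $ i))\<^sup>2) = 1"
proof -
  have n: "2 ^ (n - 1) = 2 ^ j * (2 ^ (n - 1 - j) :: nat)" "(2 :: nat) * 2 ^ (n - 1) = 2 ^ n"
    using j by (simp_all add: power_add[symmetric] power_Suc[symmetric] del: power_Suc)
  have "(\<Sum>i<2 * 2 ^ (n - 1). (cmod (split_vec n j psi $ i))\<^sup>2) =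
      (\<Sum>a<2. \<Sum>s<2 ^ (n - 1). (cmod (psi $ (a * 2 ^ j + (s mod 2 ^ j + 2 * 2 ^ j * (s div 2 ^ j)))))\<^sup>2)"
    unfolding sum_lessThan_2_mult
    by (intro sum.cong refl) (simp add: split_vec_index spread_lessThan_minus[OF j] del: One_nat_def)
  also have "\<dots> = (\<Sum>i<2 * 2 ^ (n - 1). (cmod (psi $ i))\<^sup>2)"
    unfolding n(1) by (rule sum_insert_bit) simp
  finally show ?thesis
    using assms(1) unfolding n(2) by (simp add: pure_state_def)
qed

lemma red_single:
  assumes "j < n"
  shows "red n {j} psi = ptrace_B (proj_vec (split_vec n j psi))"
proof (rule eq_matI)
  note c = ptrace_B_carrier[of "proj_vec (split_vec n j psi)"]
  fix a a' assume "a < dim_row (ptrace_B (proj_vec (split_vec n j psi)))"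
    "a' < dim_col (ptrace_B (proj_vec (split_vec n j psi)))"
  then have a: "a < 2" "a' < 2" using c by auto
  then show "red n {j} psi $$ (a, a') = ptrace_B (proj_vec (split_vec n j psi)) $$ (a, a')"
    by (simp add: red_def Let_def spread_single card_lessThan_minus[OF assms] split_vec_index
        ptrace_B_proj_vec_index[OF split_vec_carrier] del: One_nat_def card_Diff_insert card_Diff_singleton)
qed (use ptrace_B_carrier[of "proj_vec (split_vec n j psi)"] in \<open>auto simp: red_def Let_def\<close>)

text \<open>Each environment index \<open>s\<close> contributes a rank-one term. The size is written
  \<open>2 * 2\<close> to match the results on a qubit and a system of dimension d = 2.\<close>

lemma psd_red2: "psd (2 * 2) (red2 n j k psi)"
  by (rule psd_gramI[where S = "{..<2 ^ card ({..<n} - {j, k})}" and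
        f = "\<lambda>s i. psi $ ((i div 2) * 2 ^ j + (i mod 2) * 2 ^ k + spread ({..<n} - {j, k}) s)"])
    (auto simp: red2_def Let_def)

section \<open>Bounds on the monogamy scores\<close>

lemma mono_score_le:
  assumes "j < n" "\<And>k. Q2 j k \<ge> 0"
  shows "mono_score n Q Q2 \<le> Q j"
proof -
  have "mono_score n Q Q2 \<le> Q j - (\<Sum>k\<in>{..<n} - {j}. Q2 j k)"
    unfolding mono_score_def using assms(1) by (intro Min_le) auto
  also have "\<dots> \<le> Q j"
    using assms(2) by (simp add: sum_nonneg)
  finally show ?thesis .
qed

theorem theorem1:
  fixes n :: nat and psi :: "complex vec"
  assumes "n \<ge> 3"
    and "pure_state n psi"
    and "\<exists>j<n. max_eig (red n {j} psi) = max_lambda_sq n psi"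
  shows "delta_C2 n psi \<le> 4 * GGM n psi * (1 - GGM n psi)
       \<and> delta_N2 n psi \<le> GGM n psi * (1 - GGM n psi)
       \<and> delta_D n psi \<le> bin_entropy (GGM n psi)
       \<and> delta_WD n psi \<le> bin_entropy (GGM n psi)"
proof -
  obtain j where j: "j < n" and max: "max_eig (red n {j} psi) = max_lambda_sq n psi"
    using assms(3) by blast
  define phi where "phi = split_vec n j psi"
  define rho where "rho = red n {j} psi"
  have phi: "phi \<in> carrier_vec (2 * 2 ^ (n - 1))"
    unfolding phi_def by (rule split_vec_carrier)
  have norm: "(\<Sum>i<2 * 2 ^ (n - 1). (cmod (phi $ i))\<^sup>2) = 1"
    unfolding phi_def by (rule norm_split_vec[OF assms(2) j])
  have rho: "ptrace_B (proj_vec phi) = rho"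
    unfolding phi_def rho_def by (rule red_single[OF j, symmetric])
  obtain E a where E: "spectral 2 rho E a" and a: "\<And>i. i < 2 \<Longrightarrow> a i \<ge> 0"
    using psd_spectral_exists[OF psd_ptrace_B[OF psd_proj_vec[OF phi]]] unfolding rho by blast
  have "complex_of_real (a 0 + a 1) = mtrace rho"
    using mtrace_spectral[OF E] by (simp add: sum_lessThan_2)
  also have "\<dots> = complex_of_real 1"
    using norm phi unfolding rho[symmetric]
    by (simp only: mtrace_ptrace_B[OF proj_vec_carrier[OF phi]] mtrace_proj_vec carrier_vecD)
  finally have sum: "a 0 + a 1 = 1"
    by (simp only: of_real_eq_iff)
  have "Re ` set_mset (eig_mset rho) = {a 0, a 1}"
    by (auto simp: eig_mset_spectral[OF E] image_image less_2_cases_iff)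
  \<comment> \<open>The choice of \<open>j\<close> replaces the maximum over all bipartitions by the
    spectrum of one qubit.\<close>
  then have G: "GGM n psi = 1 - Max {a 0, a 1}"
    using max by (simp add: GGM_def max_eig_def rho_def)
  have "Max {a 0, a 1} = max (a 0) (a 1)"
    by simp
  \<comment> \<open>The measure is the smaller eigenvalue. Which index carries it is immaterial, as
    the bounds are symmetric under exchanging x and 1 - x.\<close>
  then have GGM_cases: "GGM n psi = a 0 \<and> 1 - GGM n psi = a 1 \<or> GGM n psi = a 1 \<and> 1 - GGM n psi = a 0"
    using G sum by linarith
  then have prod: "GGM n psi * (1 - GGM n psi) = a 0 * a 1"
    by (elim disjE conjE) (simp_all only: mult.commute)
  have bin: "bin_entropy (GGM n psi) = - (xlog (a 0) + xlog (a 1))"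
    using GGM_cases unfolding bin_entropy_def by (elim disjE conjE) simp_all
  have det: "Re (det rho) = a 0 * a 1"
    using det_spectral[OF E] by (simp add: numeral_2_eq_2)
  have entropy: "vn_entropy rho = bin_entropy (GGM n psi)"
    by (simp add: bin vn_entropy_spec_sum spec_sum_spectral[OF E] sum_lessThan_2)
  have "delta_C2 n psi \<le> (conc_pure1 n j psi)\<^sup>2"
    unfolding delta_C2_def by (rule mono_score_le[OF j]) simp
  also have "\<dots> = 4 * GGM n psi * (1 - GGM n psi)"
    using a[of 0] a[of 1] by (simp add: conc_pure1_def rho_def[symmetric] det power_mult_distrib mult.assoc prod)
  finally have C2: "delta_C2 n psi \<le> 4 * GGM n psi * (1 - GGM n psi)" .
  have "delta_N2 n psi \<le> (negativity (proj_vec phi))\<^sup>2"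
    unfolding delta_N2_def phi_def by (rule mono_score_le[OF j]) simp
  also have "\<dots> = GGM n psi * (1 - GGM n psi)"
    by (simp add: negativity_pure[OF phi norm] rho det prod)
  finally have N2: "delta_N2 n psi \<le> GGM n psi * (1 - GGM n psi)" .
  have "delta_D n psi \<le> discord (proj_vec phi)"
    unfolding delta_D_def phi_def by (rule mono_score_le[OF j]) (rule discord_nonneg[OF psd_red2])
  also have "\<dots> = bin_entropy (GGM n psi)"
    by (simp add: discord_pure[OF phi norm] rho entropy)
  finally have D: "delta_D n psi \<le> bin_entropy (GGM n psi)" .
  have "delta_WD n psi \<le> work_deficit (proj_vec phi)"
    unfolding delta_WD_def phi_def by (rule mono_score_le[OF j]) (rule work_deficit_nonneg[OF psd_red2])
  also have "\<dots> \<le> bin_entropy (GGM n psi)"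
    using work_deficit_pure[OF phi norm] by (simp add: rho entropy)
  finally show ?thesis
    using C2 N2 D by blast
qed

end
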